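(* Let $G$ be a finite simple graph whose complement $G^c$ is chordal. Let $m_G$ be the least common multiple of the generators $x_ix_j$, $\{i,j\}\in E(G)$, of the edge ideal $I(G)$. Then the order complex $\Delta((1,m_G))$ of the open interval $(1,m_G)$ in the lcm-lattice $L(I(G))$ is constructible.
   Context: The edge ideal is $I(G)=(x_ix_j:\ \{i,j\}\in E(G))$ in a polynomial ring over a field with variables indexed by $V(G)$; $G^c$ is the graph on $V(G)$ whose edges are the non-edges of $G$; a graph is chordal if it has no induced cycle of length $>3$. The lcm-lattice $L(I)$ of a monomial ideal $I$ is the set of least common multiples of subsets of the minimal monomial generators (the empty subset giving $1$), ordered by divisibility. The order complex of a poset is the simplicial complex of its finite chains. A pure simplicial complex $\Delta$ is constructible if it is a simplex or empty, or, inductively, if $\Delta=\Delta_1\cup\Delta_2$ where $\Delta_1,\Delta_2,\Delta_1\cap\Delta_2$ are constructible and $\dim\Delta_1=\dim\Delta_2=\dim(\Delta_1\cap\Delta_2)+1$. *)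

theory Defs
  imports "HOL-Algebra.Ideal" "HOL-Library.Poly_Mapping"
begin

section \<open>Graphs\<close>

definition fin_simple_graph :: "'a set \<Rightarrow> 'a set set \<Rightarrow> bool" where
  "fin_simple_graph V E \<longleftrightarrow> finite V \<and> (\<forall>e\<in>E. e \<subseteq> V \<and> card e = 2)"

definition complement_edges :: "'a set \<Rightarrow> 'a set set \<Rightarrow> 'a set set" where
  "complement_edges V E = {e. e \<subseteq> V \<and> card e = 2 \<and> e \<notin> E}"

definition induced_cycle :: "'a set \<Rightarrow> 'a set set \<Rightarrow> 'a list \<Rightarrow> bool" where
  "induced_cycle V E c \<longleftrightarrow>
     length c \<ge> 3 \<and> distinct c \<and> set c \<subseteq> V \<and>
     (\<forall>i<length c. \<forall>j<length c. {c ! i, c ! j} \<in> E \<longleftrightarrow>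
        j = Suc i mod length c \<or> i = Suc j mod length c)"

definition chordal :: "'a set \<Rightarrow> 'a set set \<Rightarrow> bool" where
  "chordal V E \<longleftrightarrow> \<not> (\<exists>c. induced_cycle V E c \<and> length c > 3)"


section \<open>Monomials and polynomials\<close>

text \<open>A monomial is represented by its exponent vector, so that the product of monomials is
  the sum of exponent vectors and the monomial 1 is the zero vector.\<close>

type_synonym 'a mon = "'a \<Rightarrow>\<^sub>0 nat"
type_synonym ('a, 'k) mpol = "'a mon \<Rightarrow>\<^sub>0 'k"

definition mon_dvd :: "'a mon \<Rightarrow> 'a mon \<Rightarrow> bool" where
  "mon_dvd s t \<longleftrightarrow> (\<exists>u. t = s + u)"

definition mon_lcm :: "'a mon set \<Rightarrow> 'a mon" where
  "mon_lcm A = (THE m. (\<forall>a\<in>A. mon_dvd a m) \<and>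
                       (\<forall>n. (\<forall>a\<in>A. mon_dvd a n) \<longrightarrow> mon_dvd m n))"

definition mon_pol :: "'a mon \<Rightarrow> ('a, 'k::field) mpol" where
  "mon_pol m = Poly_Mapping.single m 1"

definition pol_var :: "'a \<Rightarrow> ('a, 'k::field) mpol" where
  "pol_var i = mon_pol (Poly_Mapping.single i 1)"

text \<open>The polynomial ring over \<open>'k\<close> whose variables are indexed by the elements of \<open>V\<close>.\<close>

definition poly_ring :: "'a set \<Rightarrow> ('a, 'k::field) mpol ring" where
  "poly_ring V =
     \<lparr>carrier = {p. \<forall>m \<in> Poly_Mapping.keys p. Poly_Mapping.keys m \<subseteq> V},
      mult = (*), one = 1, zero = 0, add = (+)\<rparr>"

definition edge_ideal :: "'a set \<Rightarrow> 'a set set \<Rightarrow> ('a, 'k::field) mpol set" where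
  "edge_ideal V E = genideal (poly_ring V) {pol_var i * pol_var j | i j. {i, j} \<in> E}"

text \<open>The exponent vectors of the generators of the edge ideal.\<close>

definition edge_monomials :: "'a set set \<Rightarrow> 'a mon set" where
  "edge_monomials E =
     {Poly_Mapping.single i 1 + Poly_Mapping.single j 1 | i j. {i, j} \<in> E}"


section \<open>The lcm-lattice\<close>

text \<open>The minimal monomial generators of a monomial ideal \<open>I\<close> are the elements of its unique
  inclusion-minimal generating set of monomials (in
  particular, for an edge ideal of a finite graph they are the monomials of the edges).\<close>

definition min_mon_gens :: "'a set \<Rightarrow> ('a, 'k::field) mpol set \<Rightarrow> 'a mon set" where
  "min_mon_gens V I =
     (THE B. genideal (poly_ring V) (mon_pol ` B) = I \<and>
             (\<forall>C. C \<subset> B \<longrightarrow> genideal (poly_ring V) (mon_pol ` C) \<noteq> I))"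

definition lcm_lattice :: "'a set \<Rightarrow> ('a, 'k::field) mpol set \<Rightarrow> 'a mon set" where
  "lcm_lattice V I = {mon_lcm A | A. A \<subseteq> min_mon_gens V I}"

definition open_interval :: "('b \<Rightarrow> 'b \<Rightarrow> bool) \<Rightarrow> 'b set \<Rightarrow> 'b \<Rightarrow> 'b \<Rightarrow> 'b set" where
  "open_interval r P a b = {x \<in> P. r a x \<and> x \<noteq> a \<and> r x b \<and> x \<noteq> b}"


section \<open>Simplicial complexes\<close>

text \<open>Complexes are finite and always contain the empty face, which has dimension \<open>-1\<close>. In
  particular the empty complex is \<open>{{}}\<close>, of dimension \<open>-1\<close>.\<close>

definition simplicial_complex :: "'b set set \<Rightarrow> bool" where
  "simplicial_complex \<Delta> \<longleftrightarrow>
     finite \<Delta> \<and> {} \<in> \<Delta> \<and> (\<forall>\<sigma>\<in>\<Delta>. finite \<sigma> \<and> (\<forall>\<tau>. \<tau> \<subseteq> \<sigma> \<longrightarrow> \<tau> \<in> \<Delta>))"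

definition face_dim :: "'b set \<Rightarrow> int" where
  "face_dim \<sigma> = int (card \<sigma>) - 1"

definition complex_dim :: "'b set set \<Rightarrow> int" where
  "complex_dim \<Delta> = Max (face_dim ` \<Delta>)"

definition is_facet :: "'b set set \<Rightarrow> 'b set \<Rightarrow> bool" where
  "is_facet \<Delta> \<sigma> \<longleftrightarrow> \<sigma> \<in> \<Delta> \<and> (\<forall>\<tau>\<in>\<Delta>. \<sigma> \<subseteq> \<tau> \<longrightarrow> \<tau> = \<sigma>)"

definition pure_complex :: "'b set set \<Rightarrow> bool" where
  "pure_complex \<Delta> \<longleftrightarrow>
     simplicial_complex \<Delta> \<and> (\<forall>\<sigma>. is_facet \<Delta> \<sigma> \<longrightarrow> face_dim \<sigma> = complex_dim \<Delta>)"

inductive constructible :: "'b set set \<Rightarrow> bool" where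
  empty: "constructible {{}}"
| simplex: "finite \<sigma> \<Longrightarrow> constructible (Pow \<sigma>)"
| union: "\<lbrakk>pure_complex (\<Delta>1 \<union> \<Delta>2);
           constructible \<Delta>1; constructible \<Delta>2; constructible (\<Delta>1 \<inter> \<Delta>2);
           complex_dim \<Delta>1 = complex_dim \<Delta>2;
           complex_dim \<Delta>2 = complex_dim (\<Delta>1 \<inter> \<Delta>2) + 1\<rbrakk>
          \<Longrightarrow> constructible (\<Delta>1 \<union> \<Delta>2)"

definition order_complex :: "('b \<Rightarrow> 'b \<Rightarrow> bool) \<Rightarrow> 'b set \<Rightarrow> 'b set set" where
  "order_complex r P = {C. finite C \<and> C \<subseteq> P \<and> Complete_Partial_Order.chain r C}"

end

theory Submission
  imports Defs
begin

text \<open>Identify squarefree monomials with vertex sets, so that the lcm-lattice of \<open>I(G)\<close>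
  becomes the lattice of unions of edges. By Dirac's theorem \<open>G\<^sup>c\<close> has a simplicial vertex \<open>v\<close>,
  which means that every edge of \<open>G - v\<close> meets the neighbourhood of \<open>v\<close> in \<open>G\<close>. Listing the
  edges at such a vertex first and recursing on \<open>G - v\<close> orders the edges so that \<open>I(G)\<close> has
  linear quotients. The order complex is the union, over the edges \<open>e\<close> in this order, of the cones
  with apex \<open>e\<close> over the order complexes of the open intervals above \<open>e\<close>. Linear quotients force
  each cone to meet the union of the previous ones in the chains lying above one of certain atoms
  of the upper interval. Since that interval is the lattice of feasible sets of an antimatroid,
  such intersections are constructible by induction.\<close>

section \<open>Constructible complexes\<close>

lemma complex_dim_Pow:
  assumes "finite \<sigma>"
  shows "complex_dim (Pow \<sigma>) = int (card \<sigma>) - 1"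
  unfolding complex_dim_def
proof (rule Max_eqI)
  show "finite (face_dim ` Pow \<sigma>)" using assms by simp
  show "int (card \<sigma>) - 1 \<in> face_dim ` Pow \<sigma>" by (auto simp: face_dim_def)
  show "y \<le> int (card \<sigma>) - 1" if "y \<in> face_dim ` Pow \<sigma>" for y
    using that assms by (auto simp: face_dim_def dest: card_mono)
qed

lemma pure_complex_Pow:
  assumes "finite \<sigma>"
  shows "pure_complex (Pow \<sigma>)"
proof -
  have "\<tau> = \<sigma>" if "is_facet (Pow \<sigma>) \<tau>" for \<tau>
    using that unfolding is_facet_def by blast
  then show ?thesis
    using assms complex_dim_Pow[OF assms] unfolding pure_complex_def simplicial_complex_def
    by (auto simp: face_dim_def intro: finite_subset)
qed

lemma pure_complex_empty: "pure_complex {{}}"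
  using pure_complex_Pow[of "{}"] by simp

lemma constructible_imp_pure_complex:
  "constructible \<Delta> \<Longrightarrow> pure_complex \<Delta>"
  by (induction rule: constructible.induct) (auto simp: pure_complex_Pow pure_complex_empty)

lemma constructible_imp_simplicial_complex:
  "constructible \<Delta> \<Longrightarrow> simplicial_complex \<Delta>"
  using constructible_imp_pure_complex pure_complex_def by blast

lemma complex_dim_union:
  assumes "simplicial_complex \<Delta>1" "simplicial_complex \<Delta>2"
  shows "complex_dim (\<Delta>1 \<union> \<Delta>2) = max (complex_dim \<Delta>1) (complex_dim \<Delta>2)"
proof -
  have "finite \<Delta>1" "\<Delta>1 \<noteq> {}" "finite \<Delta>2" "\<Delta>2 \<noteq> {}"
    using assms unfolding simplicial_complex_def by blast+
  then show ?thesis unfolding complex_dim_def image_Un by (intro Max_Un) simp_all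
qed

text \<open>A facet of the union is a facet of whichever part contains it. This supplies the purity
  premise of \<open>constructible.union\<close>, so that only dimensions remain to be
  compared.\<close>

lemma pure_complex_union:
  assumes "pure_complex \<Delta>1" "pure_complex \<Delta>2" "complex_dim \<Delta>1 = complex_dim \<Delta>2"
  shows "pure_complex (\<Delta>1 \<union> \<Delta>2)"
proof -
  have dim: "complex_dim (\<Delta>1 \<union> \<Delta>2) = complex_dim \<Delta>1"
    using assms by (simp add: pure_complex_def complex_dim_union)
  have "simplicial_complex (\<Delta>1 \<union> \<Delta>2)"
    using assms unfolding pure_complex_def simplicial_complex_def by blast
  moreover have "face_dim \<sigma> = complex_dim \<Delta>1" if "is_facet (\<Delta>1 \<union> \<Delta>2) \<sigma>" for \<sigma>
  proof -
    have "is_facet \<Delta>1 \<sigma> \<or> is_facet \<Delta>2 \<sigma>" using that unfolding is_facet_def by blast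
    then show ?thesis using assms unfolding pure_complex_def by metis
  qed
  ultimately show ?thesis using dim unfolding pure_complex_def by simp
qed

text \<open>Every gluing compares three dimensions, so the dimension travels together with
  constructibility.\<close>

definition constructible_of_dim :: "'b set set \<Rightarrow> int \<Rightarrow> bool" where
  "constructible_of_dim \<Delta> d \<longleftrightarrow> constructible \<Delta> \<and> complex_dim \<Delta> = d"

lemma constructible_of_dim_empty: "constructible_of_dim {{}} (- 1)"
  using constructible.empty complex_dim_Pow[of "{}"] by (simp add: constructible_of_dim_def)

lemma constructible_of_dim_union:
  assumes "constructible_of_dim \<Delta>1 d" "constructible_of_dim \<Delta>2 d"
    and "constructible_of_dim (\<Delta>1 \<inter> \<Delta>2) (d - 1)"
  shows "constructible_of_dim (\<Delta>1 \<union> \<Delta>2) d"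
  using assms constructible.union[of \<Delta>1 \<Delta>2] pure_complex_union[of \<Delta>1 \<Delta>2]
    complex_dim_union[of \<Delta>1 \<Delta>2]
  unfolding constructible_of_dim_def
  by (simp add: constructible_imp_pure_complex constructible_imp_simplicial_complex)

section \<open>Cones and relabelled complexes\<close>

definition cone :: "'b \<Rightarrow> 'b set set \<Rightarrow> 'b set set" where
  "cone v \<Delta> = \<Delta> \<union> insert v ` \<Delta>"

lemma complex_dim_cone:
  assumes "simplicial_complex \<Delta>" "v \<notin> \<Union>\<Delta>"
  shows "complex_dim (cone v \<Delta>) = complex_dim \<Delta> + 1"
proof -
  have fin: "finite \<Delta>" "\<Delta> \<noteq> {}" and finf: "\<And>\<sigma>. \<sigma> \<in> \<Delta> \<Longrightarrow> finite \<sigma>"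
    using assms unfolding simplicial_complex_def by auto
  have ins: "face_dim (insert v \<sigma>) = face_dim \<sigma> + 1" if "\<sigma> \<in> \<Delta>" for \<sigma>
    using that assms(2) finf by (auto simp: face_dim_def card_insert_if)
  have bound: "face_dim \<sigma> \<le> complex_dim \<Delta>" if "\<sigma> \<in> \<Delta>" for \<sigma>
    using fin that unfolding complex_dim_def by simp
  have "complex_dim \<Delta> \<in> face_dim ` \<Delta>"
    using fin unfolding complex_dim_def by (intro Max_in) auto
  then obtain \<sigma> where \<sigma>: "\<sigma> \<in> \<Delta>" "face_dim \<sigma> = complex_dim \<Delta>" by auto
  have "Max (face_dim ` cone v \<Delta>) = complex_dim \<Delta> + 1"
  proof (rule Max_eqI)
    show "finite (face_dim ` cone v \<Delta>)" using fin by (simp add: cone_def)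
    show "y \<le> complex_dim \<Delta> + 1" if "y \<in> face_dim ` cone v \<Delta>" for y
      using that bound ins by (force simp: cone_def)
    show "complex_dim \<Delta> + 1 \<in> face_dim ` cone v \<Delta>"
      using \<sigma> ins[of \<sigma>] by (intro image_eqI[of _ _ "insert v \<sigma>"]) (simp_all add: cone_def)
  qed
  then show ?thesis by (simp add: complex_dim_def)
qed

text \<open>Coning from a new vertex commutes with unions and intersections and turns both base
  cases into simplices, so it can be pushed through the inductive construction.\<close>

lemma constructible_of_dim_cone:
  assumes "constructible_of_dim \<Delta> d" "v \<notin> \<Union>\<Delta>"
  shows "constructible_of_dim (cone v \<Delta>) (d + 1)"
proof -
  have "constructible \<Delta>" using assms(1) by (simp add: constructible_of_dim_def)
  then have "constructible (cone v \<Delta>)" using assms(2)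
  proof (induction rule: constructible.induct)
    case empty
    have "cone v {{}} = Pow {v}" by (auto simp: cone_def)
    then show ?case using constructible.simplex[of "{v}"] by simp
  next
    case (simplex \<sigma>)
    have "cone v (Pow \<sigma>) = Pow (insert v \<sigma>)" by (simp add: cone_def Pow_insert)
    then show ?case using constructible.simplex[of "insert v \<sigma>"] simplex by simp
  next
    case (union \<Delta>1 \<Delta>2)
    have v: "v \<notin> \<Union>\<Delta>1" "v \<notin> \<Union>\<Delta>2" "v \<notin> \<Union>(\<Delta>1 \<inter> \<Delta>2)" using union.prems by auto
    have un: "cone v (\<Delta>1 \<union> \<Delta>2) = cone v \<Delta>1 \<union> cone v \<Delta>2" by (auto simp: cone_def)
    \<comment> \<open>Faces through the apex agree only if their bases do, because \<open>v\<close>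
      lies in neither base; hence the two cones meet in no more than the cone over the
      intersection.\<close>
    have "insert v \<sigma> = insert v \<tau> \<Longrightarrow> \<sigma> = \<tau>" if "\<sigma> \<in> \<Delta>1" "\<tau> \<in> \<Delta>2" for \<sigma> \<tau>
      using that v by (metis UnionI insert_ident)
    then have int: "cone v \<Delta>1 \<inter> cone v \<Delta>2 = cone v (\<Delta>1 \<inter> \<Delta>2)"
      using v by (auto simp: cone_def)
    note scs = union.hyps(2-4)[THEN constructible_imp_simplicial_complex]
    have "constructible_of_dim (cone v \<Delta>1 \<union> cone v \<Delta>2) (complex_dim \<Delta>1 + 1)"
      using constructible_of_dim_union[of "cone v \<Delta>1" "complex_dim \<Delta>1 + 1" "cone v \<Delta>2"]
        union.IH union.hyps v scs int
      by (simp add: constructible_of_dim_def complex_dim_cone)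
    then show ?case by (simp add: constructible_of_dim_def un)
  qed
  then show ?thesis
    using assms by (simp add: constructible_of_dim_def complex_dim_cone
        constructible_imp_simplicial_complex)
qed

lemma complex_dim_image:
  assumes "inj_on f (\<Union>\<Delta>)"
  shows "complex_dim ((`) f ` \<Delta>) = complex_dim \<Delta>"
proof -
  have "face_dim (f ` \<sigma>) = face_dim \<sigma>" if "\<sigma> \<in> \<Delta>" for \<sigma>
    using that assms by (simp add: face_dim_def card_image inj_on_subset Union_upper)
  then have "face_dim ` (`) f ` \<Delta> = face_dim ` \<Delta>"
    unfolding image_image by (rule image_cong[OF refl])
  then show ?thesis by (simp add: complex_dim_def)
qed

text \<open>An injective renaming of vertices respects unions, intersections and dimensions. It
  carries the final result from vertex sets to monomials.\<close>

lemma constructible_image: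
  assumes "constructible \<Delta>" "inj_on f (\<Union>\<Delta>)"
  shows "constructible ((`) f ` \<Delta>)"
  using assms
proof (induction rule: constructible.induct)
  case empty
  then show ?case using constructible.empty by simp
next
  case (simplex \<sigma>)
  then show ?case using constructible.simplex[of "f ` \<sigma>"] by (simp add: image_Pow_surj)
next
  case (union \<Delta>1 \<Delta>2)
  have inj: "inj_on f (\<Union>\<Delta>1)" "inj_on f (\<Union>\<Delta>2)" "inj_on f (\<Union>(\<Delta>1 \<inter> \<Delta>2))"
    using union.prems by (auto intro: inj_on_subset)
  have "inj_on ((`) f) (\<Delta>1 \<union> \<Delta>2)"
    using union.prems by (intro inj_on_image)
  then have int: "(`) f ` \<Delta>1 \<inter> (`) f ` \<Delta>2 = (`) f ` (\<Delta>1 \<inter> \<Delta>2)"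
    by (rule inj_on_image_Int[symmetric]) auto
  have "constructible_of_dim ((`) f ` \<Delta>1 \<union> (`) f ` \<Delta>2) (complex_dim \<Delta>1)"
    using union inj int
    by (intro constructible_of_dim_union) (simp_all add: constructible_of_dim_def complex_dim_image)
  then show ?case by (simp add: constructible_of_dim_def image_Un)
qed

section \<open>Linear quotients and unions of edges\<close>

text \<open>Reading sets as squarefree monomials, the last premise says that the colon ideal of the
  earlier monomials by \<open>e\<close> is generated by variables: \<open>g\<close> puts the
  variable of \<open>a\<close> into it, and this variable divides the generator contributed by
  \<open>f\<close>. The order of the edges is hidden in the derivation.\<close>

inductive linear_quotients :: "'a set set \<Rightarrow> bool" where
  empty: "linear_quotients {}"
| insert: "\<lbrakk>linear_quotients E; e \<notin> E; \<And>f. f \<in> E \<Longrightarrow> \<exists>a\<in>f - e. \<exists>g\<in>E. g \<subseteq> insert a e\<rbrakk>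
    \<Longrightarrow> linear_quotients (insert e E)"

text \<open>Whichever of the two comes later acts as the newly inserted set, and \<open>g\<close>
  differs from it because \<open>g\<close> came earlier. The disjunction frees later arguments from
  the order.\<close>

lemma linear_quotients_link:
  assumes "linear_quotients E" "e \<in> E" "f \<in> E" "e \<noteq> f"
  shows "(\<exists>a\<in>f - e. \<exists>g\<in>E. g \<noteq> e \<and> g \<subseteq> insert a e) \<or> (\<exists>a\<in>e - f. \<exists>g\<in>E. g \<noteq> f \<and> g \<subseteq> insert a f)"
  using assms
proof (induction arbitrary: e f rule: linear_quotients.induct)
  case (insert E h)
  consider "e = h" "f \<in> E" | "f = h" "e \<in> E" | "e \<in> E" "f \<in> E"
    using insert.prems by auto
  then show ?case
  proof cases
    case 1
    then show ?thesis using insert.hyps(2,3) by (metis insertCI)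
  next
    case 2
    then show ?thesis using insert.hyps(2,3) by (metis insertCI)
  next
    case 3
    then show ?thesis using insert.IH[OF 3 insert.prems(3)] by (meson insertI2)
  qed
qed simp

text \<open>When every \<open>insert a W\<close> with \<open>a \<in> A\<close> is in
  \<open>L\<close>, these are the chains of the open interval from \<open>W\<close> to
  \<open>U\<close> that lie weakly above one of the atoms \<open>insert a W\<close>. The empty chain
  is included as soon as \<open>A\<close> is nonempty.\<close>

definition chains_through :: "'a set set \<Rightarrow> 'a set \<Rightarrow> 'a set \<Rightarrow> 'a set \<Rightarrow> 'a set set set" where
  "chains_through L U W A =
     {C \<in> order_complex (\<subseteq>) {x \<in> L. W \<subset> x \<and> x \<subset> U}. \<exists>a\<in>A. \<forall>x\<in>C. a \<in> x}"

lemma chains_through_iff: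
  "C \<in> chains_through L U W A \<longleftrightarrow> finite C \<and> Complete_Partial_Order.chain (\<subseteq>) C \<and>
     (\<forall>x\<in>C. x \<in> L \<and> W \<subset> x \<and> x \<subset> U) \<and> (\<exists>a\<in>A. \<forall>x\<in>C. a \<in> x)"
  unfolding chains_through_def order_complex_def by auto

lemma finite_chain_least:
  assumes "finite C" "C \<noteq> {}" "Complete_Partial_Order.chain (\<subseteq>) C"
  obtains m where "m \<in> C" "\<And>x. x \<in> C \<Longrightarrow> m \<subseteq> x"
proof -
  obtain m where m: "m \<in> C" "\<forall>b\<in>C. b \<subseteq> m \<longrightarrow> m = b"
    using finite_has_minimal[OF assms(1,2)] by blast
  have "m \<subseteq> x" if "x \<in> C" for x
    using chainD[OF assms(3) m(1) that] m(2) that by auto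
  then show thesis by (rule that[OF m(1)])
qed

text \<open>Accessibility puts an atom below the least member of a nonempty chain, hence below all
  its members, so allowing every atom is no restriction.\<close>

lemma chains_through_atoms:
  assumes acc: "\<And>x. \<lbrakk>x \<in> L; W \<subset> x\<rbrakk> \<Longrightarrow> \<exists>a\<in>x - W. insert a W \<in> L"
    and "U \<in> L" "W \<subset> U"
  shows "chains_through L U W {a \<in> U - W. insert a W \<in> L}
    = order_complex (\<subseteq>) {x \<in> L. W \<subset> x \<and> x \<subset> U}"
proof -
  have "\<exists>a\<in>{a \<in> U - W. insert a W \<in> L}. \<forall>x\<in>C. a \<in> x"
    if C: "C \<in> order_complex (\<subseteq>) {x \<in> L. W \<subset> x \<and> x \<subset> U}" for C
  proof (cases "C = {}")
    case True
    \<comment> \<open>The empty chain still needs some atom to exist; accessibility applied to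
      \<open>U\<close> itself provides one.\<close>
    then show ?thesis using acc[OF assms(2,3)] by auto
  next
    case False
    then obtain m where m: "m \<in> C" "\<And>x. x \<in> C \<Longrightarrow> m \<subseteq> x"
      using C finite_chain_least[of C] unfolding order_complex_def by auto
    then have "m \<in> L" "W \<subset> m" "m \<subset> U" using C unfolding order_complex_def by auto
    then show ?thesis using acc[of m] m by blast
  qed
  then show ?thesis unfolding chains_through_def by blast
qed

text \<open>Deleting \<open>W\<close> from a chain weakly above \<open>W\<close> leaves a chain
  strictly above it, and \<open>W\<close> is comparable to everything there, so it can be put back
  freely.\<close>

lemma cone_order_complex:
  assumes "W \<in> L" "W \<subset> U"
  shows "{C \<in> order_complex (\<subseteq>) {x \<in> L. x \<subset> U}. \<forall>x\<in>C. W \<subseteq> x}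
    = cone W (order_complex (\<subseteq>) {x \<in> L. W \<subset> x \<and> x \<subset> U})" (is "?L = cone W ?R")
proof
  show "cone W ?R \<subseteq> ?L"
    using assms unfolding cone_def order_complex_def chain_def by blast
  show "?L \<subseteq> cone W ?R"
  proof
    fix C assume C: "C \<in> ?L"
    then have R: "C - {W} \<in> ?R" unfolding order_complex_def chain_def by blast
    show "C \<in> cone W ?R"
    proof (cases "W \<in> C")
      case True
      then have "C = insert W (C - {W})" by auto
      then show ?thesis using R unfolding cone_def by blast
    next
      case False
      then show ?thesis using R unfolding cone_def by simp
    qed
  qed
qed

text \<open>Adding an atom \<open>insert a W\<close> to the family \<open>A\<close> glues a cone over the open interval above it
  along \<open>chains_through L U (insert a W) A\<close>, which is an instance of the same statement.\<close>

lemma constructible_chains_through: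
  assumes un: "\<And>x y. x \<in> L \<Longrightarrow> y \<in> L \<Longrightarrow> x \<union> y \<in> L"
    and acc: "\<And>x y. \<lbrakk>x \<in> L; y \<in> L; x \<subset> y\<rbrakk> \<Longrightarrow> \<exists>a\<in>y - x. insert a x \<in> L"
    and U: "U \<in> L" "finite U"
    and "W \<in> L" "W \<subset> U" "A \<noteq> {}" "A \<subseteq> {a \<in> U - W. insert a W \<in> L}"
  shows "constructible_of_dim (chains_through L U W A) (int (card (U - W)) - 2)"
  using assms(5-)
\<comment> \<open>By accessibility a maximal chain from \<open>W\<close> to \<open>U\<close> grows
  by one element at a time, so \<open>card (U - W) - 1\<close> of its members lie strictly between
  the ends; this explains the dimension.\<close>
proof (induction "card (U - W)" arbitrary: W A rule: less_induct)
  case less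
  note IH = less.hyps and W = less.prems(1,2)
  have card: "card (U - insert a W) = card (U - W) - 1" "card (U - W) > 0" if "a \<in> U - W" for a
  proof -
    have "U - insert a W = (U - W) - {a}" by auto
    then show "card (U - insert a W) = card (U - W) - 1" using that by simp
    show "card (U - W) > 0" using that U(2) by (auto simp: card_gt_0_iff)
  qed
  have single: "constructible_of_dim (chains_through L U W {a}) (int (card (U - W)) - 2)"
    if a: "a \<in> U - W" "insert a W \<in> L" for a
  proof (cases "insert a W = U")
    \<comment> \<open>The only atom in play is \<open>U\<close> itself, which leaves just the empty
      chain, of dimension -1 = 1 - 2.\<close>
    case True
    then have "U - W = {a}" using a by auto
    then have "card (U - W) = 1" by simp
    moreover have "chains_through L U W {a} = {{}}"
    proof -
      have "C = {}" if "C \<in> chains_through L U W {a}" for C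
        using that True unfolding chains_through_def order_complex_def by blast
      moreover have "{} \<in> chains_through L U W {a}"
        unfolding chains_through_def order_complex_def chain_def by simp
      ultimately show ?thesis by blast
    qed
    ultimately show ?thesis using constructible_of_dim_empty by simp
  next
    case False
    let ?W = "insert a W" and ?A = "{b \<in> U - insert a W. insert b (insert a W) \<in> L}"
    have sub: "?W \<subset> U" using False a W by auto
    have "chains_through L U W {a} = {C \<in> order_complex (\<subseteq>) {x \<in> L. x \<subset> U}. \<forall>x\<in>C. ?W \<subseteq> x}"
      using a unfolding chains_through_def order_complex_def by blast
    also have "\<dots> = cone ?W (order_complex (\<subseteq>) {x \<in> L. ?W \<subset> x \<and> x \<subset> U})"
      by (rule cone_order_complex[OF a(2) sub])
    also have "\<dots> = cone ?W (chains_through L U ?W ?A)"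
      by (rule arg_cong[OF chains_through_atoms[OF acc[OF a(2)] U(1) sub, symmetric]])
    finally have eq: "chains_through L U W {a} = cone ?W (chains_through L U ?W ?A)" .
    obtain b where "b \<in> ?A" using acc[OF a(2) U(1) sub] by blast
    then have "?A \<noteq> {}" by blast
    then have "constructible_of_dim (chains_through L U ?W ?A) (int (card (U - ?W)) - 2)"
      using a sub card[OF a(1)] by (intro IH) auto
    moreover have "?W \<notin> \<Union>(chains_through L U ?W ?A)"
      unfolding chains_through_def order_complex_def by blast
    ultimately have "constructible_of_dim (chains_through L U W {a}) (int (card (U - ?W)) - 2 + 1)"
      unfolding eq by (rule constructible_of_dim_cone)
    then show ?thesis using card[OF a(1)] by (simp add: of_nat_diff algebra_simps)
  qed
  have "finite A" using less.prems U(2) by (auto intro: finite_subset)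
  \<comment> \<open>Inner induction on \<open>A\<close> with \<open>W\<close> fixed; the outer
    hypothesis \<open>IH\<close> handles the shorter interval above the atom being added.\<close>
  then show ?case using less.prems(3,4)
  proof (induction rule: finite_ne_induct)
    case (singleton a)
    then show ?case using single by simp
  next
    case (insert a A)
    have a: "a \<in> U - W" "insert a W \<in> L" and A: "A \<subseteq> {b \<in> U - W. insert b W \<in> L}"
      using insert.prems by auto
    have eq: "chains_through L U W (insert a A) = chains_through L U W {a} \<union> chains_through L U W A"
      unfolding chains_through_def by blast
    \<comment> \<open>Since \<open>a \<notin> A\<close>, any \<open>b \<in> A\<close> lies outside
      \<open>insert a W\<close>. A chain above both atoms therefore avoids \<open>insert a W\<close>
      and belongs to the interval strictly above it.\<close>
    have int: "chains_through L U W {a} \<inter> chains_through L U W A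
        = chains_through L U (insert a W) A"
    proof (intro Set.set_eqI iffI)
      fix C assume C: "C \<in> chains_through L U W {a} \<inter> chains_through L U W A"
      then obtain b where b: "b \<in> A" "\<forall>x\<in>C. b \<in> x" by (auto simp: chains_through_iff)
      then have "b \<notin> insert a W" using A insert.hyps(3) by auto
      moreover have "\<forall>x\<in>C. W \<subset> x \<and> a \<in> x" using C by (simp add: chains_through_iff)
      ultimately have "\<forall>x\<in>C. insert a W \<subset> x" using b(2) by blast
      then show "C \<in> chains_through L U (insert a W) A" using C by (simp add: chains_through_iff)
    next
      fix C assume C: "C \<in> chains_through L U (insert a W) A"
      then have "\<forall>x\<in>C. insert a W \<subset> x" by (simp add: chains_through_iff)
      then have "\<forall>x\<in>C. W \<subset> x \<and> a \<in> x" by blast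
      then show "C \<in> chains_through L U W {a} \<inter> chains_through L U W A"
        using C by (simp add: chains_through_iff)
    qed
    \<comment> \<open>Closure under unions: the remaining atoms over \<open>W\<close> become atoms
      over \<open>insert a W\<close>, as \<open>IH\<close> requires.\<close>
    have "insert b (insert a W) \<in> L" if "b \<in> A" for b
    proof -
      have "insert b (insert a W) = insert a W \<union> insert b W" by auto
      then show ?thesis using un[of "insert a W" "insert b W"] a A that by auto
    qed
    then have A': "A \<subseteq> {b \<in> U - insert a W. insert b (insert a W) \<in> L}"
      using A insert.hyps(3) by auto
    then have "insert a W \<subset> U" using insert.hyps(2) a W by blast
    then have "constructible_of_dim (chains_through L U (insert a W) A)
        (int (card (U - insert a W)) - 2)"
      using A' insert.hyps(2) a card[OF a(1)] by (intro IH) auto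
    moreover have "int (card (U - insert a W)) - 2 = int (card (U - W)) - 2 - 1"
      using card[OF a(1)] by simp
    ultimately show ?case
      unfolding eq using constructible_of_dim_union[OF single[OF a] insert.IH[OF A]] int by simp
  qed
qed

section \<open>Accessibility of unions of edges\<close>

lemma card_2_other:
  assumes "card e = 2" "a \<in> e"
  obtains b where "e = {a, b}" "a \<noteq> b"
proof -
  obtain x y where "e = {x, y}" "x \<noteq> y" using assms(1) by (auto simp: card_2_iff)
  then show ?thesis using assms(2) that[of x] that[of y] by auto
qed

lemma card_2_subset_eq:
  assumes "card e = 2" "card f = 2" "e \<subseteq> f"
  shows "e = f"
  using assms card_subset_eq[of f e] card_ge_0_finite[of f] by simp

text \<open>Take an edge \<open>f\<close> of \<open>B\<close> not covered by \<open>A\<close>. If it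
  touches \<open>\<Union>A\<close>, adding it brings one new vertex. If not, linear quotients yield
  an edge joining \<open>f\<close> to an edge of \<open>A\<close>, and adding that one brings one
  new vertex.\<close>

lemma edges_accessible:
  assumes lq: "linear_quotients E" and two: "\<And>e. e \<in> E \<Longrightarrow> card e = 2"
    and A: "A \<subseteq> E" "A \<noteq> {}" and B: "B \<subseteq> E" and sub: "\<Union>A \<subset> \<Union>B"
  shows "\<exists>a\<in>\<Union>B - \<Union>A. \<exists>A'\<subseteq>E. A' \<noteq> {} \<and> insert a (\<Union>A) = \<Union>A'"
proof -
  have touch: ?thesis if "g \<in> E" "a \<in> \<Union>B - \<Union>A" "g \<subseteq> insert a (\<Union>A)" "a \<in> g" for g a
    using that A by (intro bexI[of _ a] exI[of _ "insert g A"]) auto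
  obtain b f where f: "f \<in> B" "b \<in> f" "b \<notin> \<Union>A" using sub by blast
  obtain c where c: "f = {b, c}" "b \<noteq> c" using card_2_other[of f b] two[of f] f B by blast
  show ?thesis
  proof (cases "c \<in> \<Union>A")
    case True
    then show ?thesis using f B c by (intro touch[of f b]) auto
  next
    case False
    obtain e where e: "e \<in> A" using A by auto
    \<comment> \<open>An edge inside \<open>insert x h\<close> but different from \<open>h\<close>
      must use \<open>x\<close>, since edges of equal size cannot be properly nested.\<close>
    have link: "x \<in> g" if "g \<in> E" "g \<noteq> h" "h \<in> E" "g \<subseteq> insert x h" for g h x
    proof (rule ccontr)
      assume "x \<notin> g"
      then have "g \<subseteq> h" using that by blast
      then show False using that card_2_subset_eq[of g h] two by blast
    qed
    have "e \<noteq> f" using e f by blast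
    \<comment> \<open>In both cases \<open>g\<close> has one end in \<open>e\<close> and the other
      in \<open>f\<close>. The new vertex is \<open>a\<close> in the first case and the other end
      \<open>d\<close> of \<open>g\<close> in the second.\<close>
    then consider a g where "a \<in> f - e" "g \<in> E" "g \<noteq> e" "g \<subseteq> insert a e"
      | a g where "a \<in> e - f" "g \<in> E" "g \<noteq> f" "g \<subseteq> insert a f"
      using linear_quotients_link[OF lq, of e f] e f A B by blast
    then show ?thesis
    proof cases
      case 1
      have "a \<in> g" using link 1 e A by blast
      then show ?thesis using 1 f c False e by (intro touch[of g a]) auto
    next
      case 2
      have ag: "a \<in> g" using link[of g f a] 2 f B by blast
      obtain d where d: "g = {a, d}" "a \<noteq> d" using card_2_other[OF two[OF 2(2)] ag] by blast
      then show ?thesis using 2 f c False e by (intro touch[of g d]) auto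
    qed
  qed
qed

text \<open>Every chain lies above some edge, so the complex is a union of cones with edges as
  apexes. They are glued in the order of linear quotients, and each has dimension
  \<open>card U - 3\<close>.\<close>

lemma constructible_edge_unions:
  fixes E :: "'a set set"
  assumes lq: "linear_quotients E" and fin: "finite (\<Union>E)" and two: "\<And>e. e \<in> E \<Longrightarrow> card e = 2"
  shows "constructible (order_complex (\<subseteq>) {\<Union>A | A. A \<subseteq> E \<and> \<Union>A \<noteq> {} \<and> \<Union>A \<noteq> \<Union>E})"
proof -
  define U where "U = \<Union>E"
  define L where "L = {\<Union>A | A. A \<subseteq> E \<and> A \<noteq> {}}"
  \<comment> \<open>\<open>T {e}\<close> is the cone belonging to \<open>e\<close>, and
    \<open>T E\<close> will turn out to be the whole complex.\<close>
  define T where "T F = {C \<in> order_complex (\<subseteq>) {x \<in> L. x \<subset> U}. \<exists>e\<in>F. \<forall>x\<in>C. e \<subseteq> x}" for F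
  have T_iff: "C \<in> T F \<longleftrightarrow> finite C \<and> Complete_Partial_Order.chain (\<subseteq>) C \<and>
      (\<forall>x\<in>C. x \<in> L \<and> x \<subset> U) \<and> (\<exists>e\<in>F. \<forall>x\<in>C. e \<subseteq> x)" for C F
    unfolding T_def order_complex_def by blast
  have ne: "e \<noteq> {}" if "e \<in> E" for e using two[OF that] by fastforce
  have LI: "x \<in> L" if "x = \<Union>A" "A \<subseteq> E" "A \<noteq> {}" for x A
    unfolding L_def mem_Collect_eq using that by (intro exI[of _ A] conjI)
  have un: "x \<union> y \<in> L" if xy: "x \<in> L" "y \<in> L" for x y
  proof -
    obtain A where A: "x = \<Union>A" "A \<subseteq> E" "A \<noteq> {}" using xy(1) unfolding L_def by blast
    obtain B where B: "y = \<Union>B" "B \<subseteq> E" "B \<noteq> {}" using xy(2) unfolding L_def by blast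
    have "x \<union> y = \<Union>(A \<union> B)" using A(1) B(1) by (simp add: Union_Un_distrib)
    then show ?thesis by (rule LI) (use A B in auto)
  qed
  have acc: "\<exists>a\<in>y - x. insert a x \<in> L" if xy: "x \<in> L" "y \<in> L" "x \<subset> y" for x y
  proof -
    obtain A where A: "x = \<Union>A" "A \<subseteq> E" "A \<noteq> {}" using xy(1) unfolding L_def by blast
    obtain B where B: "y = \<Union>B" "B \<subseteq> E" using xy(2) unfolding L_def by blast
    have "\<exists>a\<in>y - x. \<exists>A'\<subseteq>E. A' \<noteq> {} \<and> insert a x = \<Union>A'"
      unfolding A(1) B(1)
      by (rule edges_accessible[OF lq two A(2,3) B(2)]) (use xy(3) A(1) B(1) in simp_all)
    then show ?thesis using LI by meson
  qed
  have EL: "e \<in> L" if "e \<in> E" for e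
    using that LI[of e "{e}"] by simp
  have LU: "x \<subseteq> U" if "x \<in> L" for x using that unfolding L_def U_def by auto
  have UL: "U \<in> L" if "E \<noteq> {}" using that LI[of U E] by (simp add: U_def)
  have finU: "finite U" using fin by (simp add: U_def)
  have card: "card (U - e) + 2 = card U" if "e \<in> E" for e
    using two[OF that] LU[OF EL[OF that]] finU
    by (metis card_Diff_subset card_mono finite_subset le_add_diff_inverse2)
  have through: "constructible_of_dim (chains_through L U e A) (int (card U) - 3 - 1)"
    if e: "e \<in> E" "e \<subset> U" and A: "A \<noteq> {}" "A \<subseteq> {a \<in> U - e. insert a e \<in> L}" for e A
  proof -
    have "U \<in> L" using UL e by auto
    have "constructible_of_dim (chains_through L U e A) (int (card (U - e)) - 2)"
      by (rule constructible_chains_through[OF un acc \<open>U \<in> L\<close> finU EL[OF e(1)] e(2) A])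
    moreover have "int (card (U - e)) - 2 = int (card U) - 3 - 1" using card[OF e(1)] by linarith
    ultimately show ?thesis by simp
  qed
  have single: "constructible_of_dim (T {e}) (int (card U) - 3)" if e: "e \<in> E" for e
  proof (cases "e = U")
    \<comment> \<open>Here \<open>U\<close> has two elements and no proper subset of it contains
      \<open>e\<close>, so the dimension is -1 = 2 - 3.\<close>
    case True
    have "C = {}" if "C \<in> T {e}" for C
    proof -
      have "e \<subseteq> x \<and> x \<subset> U" if "x \<in> C" for x using \<open>C \<in> T {e}\<close> that by (simp add: T_iff)
      then show ?thesis using True by blast
    qed
    moreover have "{} \<in> T {e}" by (simp add: T_iff chain_def)
    ultimately have "T {e} = {{}}" by blast
    then show ?thesis using constructible_of_dim_empty two[OF e] True by simp
  next
    case False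
    let ?A = "{a \<in> U - e. insert a e \<in> L}"
    have sub: "e \<subset> U" using False LU[OF EL[OF e]] by auto
    have UL: "U \<in> L" using UL e by auto
    have "T {e} = cone e (order_complex (\<subseteq>) {x \<in> L. e \<subset> x \<and> x \<subset> U})"
      using cone_order_complex[OF EL[OF e] sub] by (simp add: T_def)
    also have "\<dots> = cone e (chains_through L U e ?A)"
      by (rule arg_cong[OF chains_through_atoms[OF acc[OF EL[OF e]] UL sub, symmetric]])
    finally have eq: "T {e} = cone e (chains_through L U e ?A)" .
    obtain a where "a \<in> ?A" using acc[OF EL[OF e] UL sub] by blast
    then have "constructible_of_dim (chains_through L U e ?A) (int (card U) - 3 - 1)"
      by (intro through[OF e sub]) blast+
    moreover have "e \<notin> \<Union>(chains_through L U e ?A)" by (auto simp: chains_through_iff)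
    ultimately show ?thesis
      unfolding eq using constructible_of_dim_cone by fastforce
  qed
  \<comment> \<open>Only the initial segment \<open>F\<close> of the ordering varies;
    \<open>L\<close> and \<open>U\<close> stay those of the full edge set \<open>E\<close>.\<close>
  have main: "constructible_of_dim (T F) (int (card U) - 3)"
    if "linear_quotients F" "F \<noteq> {}" "F \<subseteq> E" for F
    using that
  proof (induction rule: linear_quotients.induct)
    case (insert F e)
    show ?case
    proof (cases "F = {}")
      case True
      then show ?thesis using single insert.prems by simp
    next
      case False
      have e: "e \<in> E" and F: "F \<subseteq> E" using insert.prems by auto
      \<comment> \<open>These are the variables generating the colon ideal at \<open>e\<close>; they
        select the atoms above \<open>e\<close> along which the new cone is glued.\<close>
      define A where "A = {a \<in> U - e. \<exists>g\<in>F. g \<subseteq> insert a e}"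
      have nsub: "\<not> g \<subseteq> e" if "g \<in> F" for g
        using that insert.hyps(2) F e two card_2_subset_eq[of g e] by blast
      have A: "a \<in> A" if "a \<in> f - e" "f \<in> F" "g \<in> F" "g \<subseteq> insert a e" for a f g
        using that F unfolding A_def U_def by blast
      have AL: "insert a e \<in> L" if a: "a \<in> A" for a
      proof -
        obtain g where g: "g \<in> F" "g \<subseteq> insert a e" using a unfolding A_def by blast
        then have "insert a e = g \<union> e" using nsub[of g] by blast
        then show ?thesis using un EL e F g by auto
      qed
      obtain f where "f \<in> F" using False by auto
      then have Ane: "A \<noteq> {}" using insert.hyps(3)[of f] A by blast
      then have sub: "e \<subset> U" using LU[OF EL[OF e]] unfolding A_def by blast
      \<comment> \<open>A chain above \<open>e\<close> and an earlier \<open>f\<close> contains the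
        \<open>a \<in> f - e\<close> given by linear quotients, hence lies strictly above
        \<open>e\<close>. Conversely \<open>e\<close> and \<open>a\<close> together cover an earlier
        edge \<open>g\<close>.\<close>
      have int: "T {e} \<inter> T F = chains_through L U e A"
      proof
        show "T {e} \<inter> T F \<subseteq> chains_through L U e A"
        proof
          fix C assume C: "C \<in> T {e} \<inter> T F"
          then obtain f where f: "f \<in> F" "\<forall>x\<in>C. f \<subseteq> x" by (auto simp: T_iff)
          obtain a g where a: "a \<in> f - e" "g \<in> F" "g \<subseteq> insert a e"
            using insert.hyps(3)[OF f(1)] by blast
          have "\<forall>x\<in>C. e \<subseteq> x" using C by (simp add: T_iff)
          then have "\<forall>x\<in>C. e \<subset> x \<and> a \<in> x" using f(2) a(1) by blast
          moreover have "a \<in> A" using A[OF a(1) f(1) a(2,3)] .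
          ultimately show "C \<in> chains_through L U e A"
            using C by (auto simp: T_iff chains_through_iff)
        qed
        show "chains_through L U e A \<subseteq> T {e} \<inter> T F"
        proof
          fix C assume C: "C \<in> chains_through L U e A"
          then obtain a where a: "a \<in> A" "\<forall>x\<in>C. a \<in> x" by (auto simp: chains_through_iff)
          then obtain g where g: "g \<in> F" "g \<subseteq> insert a e" unfolding A_def by blast
          have "\<forall>x\<in>C. e \<subset> x" using C by (simp add: chains_through_iff)
          then have "\<forall>x\<in>C. e \<subseteq> x \<and> g \<subseteq> x" using a(2) g(2) by blast
          then show "C \<in> T {e} \<inter> T F"
            using C g(1) by (auto simp: T_iff chains_through_iff)
        qed
      qed
      have "constructible_of_dim (chains_through L U e A) (int (card U) - 3 - 1)"
        using AL by (intro through[OF e sub Ane]) (auto simp: A_def)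
      then have "constructible_of_dim (T {e} \<union> T F) (int (card U) - 3)"

        using constructible_of_dim_union[OF single[OF e] insert.IH[OF False F]] int by simp
      moreover have "T {e} \<union> T F = T (insert e F)" unfolding T_def by blast
      ultimately show ?thesis by simp
    qed
  qed simp
  have LE: "{\<Union>A | A. A \<subseteq> E \<and> \<Union>A \<noteq> {} \<and> \<Union>A \<noteq> \<Union>E} = {x \<in> L. x \<subset> U}"
  proof -
    have "\<Union>A \<noteq> {} \<longleftrightarrow> A \<noteq> {}" if "A \<subseteq> E" for A using that ne by auto
    moreover have "\<Union>A \<noteq> U \<longleftrightarrow> \<Union>A \<subset> U" if "A \<subseteq> E" for A using that unfolding U_def by auto
    ultimately have "(\<Union>A \<noteq> {} \<and> \<Union>A \<noteq> U) \<longleftrightarrow> (A \<noteq> {} \<and> \<Union>A \<subset> U)" if "A \<subseteq> E" for A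
      using that by simp
    then have "{\<Union>A | A. A \<subseteq> E \<and> \<Union>A \<noteq> {} \<and> \<Union>A \<noteq> U} = {\<Union>A | A. A \<subseteq> E \<and> A \<noteq> {} \<and> \<Union>A \<subset> U}"
      by (metis (no_types, lifting))
    also have "\<dots> = {x \<in> L. x \<subset> U}" unfolding L_def by auto
    finally show ?thesis unfolding U_def .
  qed
  show ?thesis
  proof (cases "E = {}")
    case True
    then have "{x \<in> L. x \<subset> U} = {}" unfolding L_def by auto
    moreover have "order_complex (\<subseteq>) ({} :: 'a set set) = {{}}"
      by (auto simp: order_complex_def chain_def)
    ultimately show ?thesis using constructible.empty by (simp only: LE)
  next
    case False
    have "T E = order_complex (\<subseteq>) {x \<in> L. x \<subset> U}"
    proof -
      have "\<exists>e\<in>E. \<forall>x\<in>C. e \<subseteq> x" if C: "C \<in> order_complex (\<subseteq>) {x \<in> L. x \<subset> U}" for C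
      proof (cases "C = {}")
        case True
        then show ?thesis using False by auto
      next
        case False
        then obtain m where m: "m \<in> C" "\<And>x. x \<in> C \<Longrightarrow> m \<subseteq> x"
          using C finite_chain_least[of C] unfolding order_complex_def by auto
        then have "m \<in> L" using C unfolding order_complex_def by auto
        \<comment> \<open>The least member of the chain is a union of a nonempty family of edges, so
          it contains one.\<close>
        then obtain e where "e \<in> E" "e \<subseteq> m" unfolding L_def by blast
        then show ?thesis using m by blast
      qed
      then show ?thesis unfolding T_def by blast
    qed
    then show ?thesis using main[OF lq False] LE by (simp add: constructible_of_dim_def)
  qed
qed

section \<open>Simplicial vertices of chordal graphs\<close>

text \<open>The edge set is never restricted: letting \<open>a\<close> and \<open>b\<close> range
  over \<open>V\<close> already gives the notion for the subgraph induced on \<open>V\<close>. The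
  same holds for \<open>walk\<close> and \<open>chordal\<close>.\<close>

definition simplicial_vertex :: "'a set \<Rightarrow> 'a set set \<Rightarrow> 'a \<Rightarrow> bool" where
  "simplicial_vertex V F v \<longleftrightarrow>
     (\<forall>a\<in>V. \<forall>b\<in>V. {v, a} \<in> F \<longrightarrow> {v, b} \<in> F \<longrightarrow> a \<noteq> b \<longrightarrow> {a, b} \<in> F)"

section \<open>Shortest walks and induced cycles\<close>

definition walk :: "'a set \<Rightarrow> 'a set set \<Rightarrow> 'a \<Rightarrow> 'a \<Rightarrow> 'a list \<Rightarrow> bool" where
  "walk V F x y p \<longleftrightarrow> p \<noteq> [] \<and> hd p = x \<and> last p = y \<and> set p \<subseteq> V \<and>
     successively (\<lambda>a b. {a, b} \<in> F) p"

lemma walk_append: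
  assumes "walk V F x y p" "walk V F z w q" "{y, z} \<in> F"
  shows "walk V F x w (p @ q)"
  using assms by (auto simp: walk_def successively_append_iff)

lemma walk_take:
  assumes "walk V F x y p" "i < length p"
  shows "walk V F x (p ! i) (take (Suc i) p)"
proof -
  have "last (take (Suc i) p) = p ! i" using assms by (simp add: take_Suc_conv_app_nth)
  then show ?thesis
    using assms by (auto simp: walk_def successively_conv_nth hd_take dest: in_set_takeD)
qed

lemma walk_drop:
  assumes "walk V F x y p" "i < length p"
  shows "walk V F (p ! i) y (drop i p)"
  using assms by (auto simp: walk_def successively_conv_nth hd_drop_conv_nth dest: in_set_dropD)

text \<open>A repeated vertex or a chord would allow a shortcut made of an initial and a final piece
  of \<open>p\<close>.\<close>

lemma shortest_walk_induced:
  assumes p: "walk V F x y p" and short: "\<And>q. walk V F x y q \<Longrightarrow> length p \<le> length q"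
    and ij: "i < j" "j < length p"
  shows "p ! i \<noteq> p ! j" "{p ! i, p ! j} \<in> F \<longleftrightarrow> j = Suc i"
proof -
  have step: "{p ! k, p ! Suc k} \<in> F" if "Suc k < length p" for k
    using p that by (auto simp: walk_def successively_conv_nth)
  show "p ! i \<noteq> p ! j"
  proof
    assume eq: "p ! i = p ! j"
    show False
    proof (cases "Suc j < length p")
      case True
      then have "walk V F x y (take (Suc i) p @ drop (Suc j) p)"
        using walk_append[OF walk_take[OF p, of i] walk_drop[OF p True]] step[OF True] eq ij by simp
      from short[OF this] show False using ij by simp
    next
      \<comment> \<open>With \<open>j\<close> the last index there is no final piece to append; the
        initial piece up to \<open>i\<close> already ends at \<open>y\<close>.\<close>
      case False
      then have "p ! j = last p" using ij
        by (metis Suc_lessI last_conv_nth diff_Suc_1 list.size(3) not_less_zero)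
      then have "walk V F x y (take (Suc i) p)"
        using walk_take[OF p, of i] p ij eq by (simp add: walk_def)
      from short[OF this] show False using ij by simp
    qed
  qed
  show "{p ! i, p ! j} \<in> F \<longleftrightarrow> j = Suc i"
  proof
    assume "{p ! i, p ! j} \<in> F"
    then have "walk V F x y (take (Suc i) p @ drop j p)"
      using walk_append[OF walk_take[OF p, of i] walk_drop[OF p ij(2)]] ij by simp
    from short[OF this] show "j = Suc i" using ij by simp
  next
    assume "j = Suc i"
    then show "{p ! i, p ! j} \<in> F" using step ij by simp
  qed
qed

text \<open>A vertex adjacent to exactly the two ends of an induced path closes it to an induced
  cycle.\<close>

lemma induced_cycle_append_vertex:
  assumes dist: "distinct p" and len: "length p \<ge> 3" and sub: "insert v (set p) \<subseteq> V" "v \<notin> set p"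
    and loop: "\<And>a. {a} \<notin> F"
    and ind: "\<And>i j. \<lbrakk>i < j; j < length p\<rbrakk> \<Longrightarrow> {p ! i, p ! j} \<in> F \<longleftrightarrow> j = Suc i"
    and v: "\<And>i. i < length p \<Longrightarrow> {v, p ! i} \<in> F \<longleftrightarrow> i = 0 \<or> i = length p - 1"
  shows "induced_cycle V F (p @ [v])"
proof -
  let ?n = "length p" and ?c = "p @ [v]"
  have edge: "{?c ! i, ?c ! j} \<in> F \<longleftrightarrow> j = Suc i mod Suc ?n \<or> i = Suc j mod Suc ?n"
    if ij: "i \<le> j" "j \<le> ?n" for i j
  proof -
    consider "i = j" | "i < j" "j < ?n" | "i < j" "j = ?n" using ij by linarith
    then show ?thesis
    proof cases
      case 1
      have "i \<noteq> Suc i mod Suc ?n" using len ij 1 by (cases "i = ?n") auto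
      then show ?thesis using 1 loop by simp
    next
      case 2
      then show ?thesis using ind[OF 2] by (simp add: nth_append)
    next
      case 3
      then show ?thesis using v[of i] len by (auto simp: nth_append insert_commute)
    qed
  qed
  \<comment> \<open>Both sides are symmetric in \<open>i\<close> and \<open>j\<close>, so the case
    \<open>i \<le> j\<close> suffices.\<close>
  have "{?c ! i, ?c ! j} \<in> F \<longleftrightarrow> j = Suc i mod Suc ?n \<or> i = Suc j mod Suc ?n"
    if "i < Suc ?n" "j < Suc ?n" for i j
    using edge[of i j] edge[of j i] that by (cases "i \<le> j") (auto simp: insert_commute)
  then show ?thesis using assms(1-4) unfolding induced_cycle_def by simp
qed

text \<open>If \<open>x\<close> and \<open>y\<close> were not adjacent, a shortest walk between them
  through \<open>C\<close> would close up at \<open>v\<close> to an induced cycle with at least four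
  vertices.\<close>

lemma chordal_separator_clique:
  assumes ch: "chordal V F" and loop: "\<And>a. {a} \<notin> F" and CV: "C \<subseteq> V"
    and conn: "\<And>a b. \<lbrakk>a \<in> C; b \<in> C\<rbrakk> \<Longrightarrow> \<exists>p. walk C F a b p"
    and v: "v \<in> V" "v \<notin> C" "\<And>c. c \<in> C \<Longrightarrow> {v, c} \<notin> F"
    and x: "x \<in> V" "{v, x} \<in> F" "a \<in> C" "{x, a} \<in> F"
    and y: "y \<in> V" "{v, y} \<in> F" "b \<in> C" "{y, b} \<in> F"
    and ne: "x \<noteq> y"
  shows "{x, y} \<in> F"
proof (rule ccontr)
  assume xy: "{x, y} \<notin> F"
  let ?D = "insert x (insert y C)"
  obtain q where "walk C F a b q" using conn x y by blast
  then have "walk ?D F a b q" unfolding walk_def by auto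
  moreover have "walk ?D F x x [x]" "walk ?D F y y [y]" by (auto simp: walk_def)
  ultimately have "walk ?D F x y ([x] @ q @ [y])"
    using walk_append[of ?D F a b q y y "[y]"] walk_append[of ?D F x x "[x]" a y] x y
    by (auto simp: insert_commute)
  then obtain p where p: "walk ?D F x y p" and short: "\<And>q. walk ?D F x y q \<Longrightarrow> length p \<le> length q"
    using ex_has_least_nat[of "walk ?D F x y" _ length] by blast
  note ind = shortest_walk_induced[OF p short]
  have ends: "p \<noteq> []" "p ! 0 = x" "p ! (length p - 1) = y" "set p \<subseteq> ?D"
    using p by (auto simp: walk_def hd_conv_nth last_conv_nth)
  have dist: "distinct p"
    unfolding distinct_conv_nth using ind(1) by (metis nat_neq_iff)
  have vx: "v \<noteq> x" "v \<noteq> y" using x y loop by auto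
  \<comment> \<open>One vertex would force \<open>x = y\<close> and two would make
    \<open>{x, y}\<close> an edge. Three vertices together with \<open>v\<close> exceed the length
    allowed by chordality.\<close>
  have len: "length p \<ge> 3"
  proof (rule ccontr)
    assume "\<not> length p \<ge> 3"
    then have "length p = 1 \<or> length p = 2" using ends(1) length_0_conv[of p] by linarith
    then consider "length p = 1" | "length p = 2" by blast
    then show False
    proof cases
      case 1
      then show False using ends ne by simp
    next
      case 2
      then show False using ind(2)[of 0 1] ends xy by simp
    qed
  qed
  have inner: "{v, p ! i} \<in> F \<longleftrightarrow> i = 0 \<or> i = length p - 1" if i: "i < length p" for i
  proof (cases "i = 0 \<or> i = length p - 1")
    case True
    then show ?thesis using ends x y by auto
  next
    case False
    then have "p ! i \<noteq> x" "p ! i \<noteq> y" using dist i ends len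
      by (metis length_pos_if_in_set nth_eq_iff_index_eq nth_mem)
        (metis False dist i ends diff_less length_greater_0_conv nth_eq_iff_index_eq zero_less_one)
    then have "p ! i \<in> C" using ends(4) i nth_mem by blast
    then show ?thesis using v False by auto
  qed
  have "induced_cycle V F (p @ [v])"
    using ends(4) vx v x y CV
    by (intro induced_cycle_append_vertex dist len loop ind(2) inner) auto
  then show False using ch len unfolding chordal_def by fastforce
qed

text \<open>Dirac's theorem, in a form that can be proved by induction: \<open>C\<close> is a connected component
  of the non-neighbours of \<open>v\<close>, and its boundary \<open>S\<close> is a clique, so a vertex of \<open>C\<close> that is
  simplicial in \<open>C \<union> S\<close> is simplicial in the whole graph.\<close>

lemma chordal_simplicial_nonneighbour:
  assumes "finite V" "chordal V F" and loop: "\<And>a. {a} \<notin> F"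
    and "v \<in> V" "w \<in> V" "v \<noteq> w" "{v, w} \<notin> F"
  shows "\<exists>t\<in>V. t \<noteq> v \<and> {v, t} \<notin> F \<and> simplicial_vertex V F t"
  using assms(1,2,4-)
proof (induction "card V" arbitrary: V v w rule: less_induct)
  case less
  define N where "N = {u \<in> V. u \<noteq> v \<and> {v, u} \<notin> F}"
  define C where "C = {u. \<exists>p. walk N F w u p}"
  define S where "S = {s \<in> V - C. \<exists>c\<in>C. {s, c} \<in> F}"
  have wC: "w \<in> C"
    using less.prems unfolding C_def N_def by (auto simp: walk_def intro!: exI[of _ "[w]"])
  have CN: "C \<subseteq> N" unfolding C_def walk_def using last_in_set by blast
  have ext: "u \<in> C" if cu: "c \<in> C" "u \<in> N" "{c, u} \<in> F" for c u
  proof -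
    obtain p where "walk N F w c p" using cu unfolding C_def by blast
    then have "walk N F w u (p @ [u])"
      using cu by (intro walk_append) (auto simp: walk_def)
    then show ?thesis unfolding C_def by blast
  qed
  \<comment> \<open>A walk from \<open>w\<close> inside \<open>N\<close> never leaves
    \<open>C\<close>, so the component is connected by walks of its own.\<close>
  have walkC: "walk C F w u p" if "walk N F w u p" for u p
  proof -
    have "p ! i \<in> C" if "i < length p" for i
      using that
    proof (induction i)
      case 0
      then show ?case using \<open>walk N F w u p\<close> wC by (auto simp: walk_def hd_conv_nth)
    next
      case (Suc i)
      have "{p ! i, p ! Suc i} \<in> F" "p ! Suc i \<in> N"
        using \<open>walk N F w u p\<close> Suc.prems by (auto simp: walk_def successively_conv_nth)
      then show ?case using ext Suc by auto
    qed
    then have "set p \<subseteq> C" by (auto simp: in_set_conv_nth)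
    then show ?thesis using that by (simp add: walk_def)
  qed
  have rev: "walk C F b a (rev p)" if "walk C F a b p" for a b p
    using that by (auto simp: walk_def hd_rev last_rev insert_commute)
  have conn: "\<exists>p. walk C F a b p" if ab: "a \<in> C" "b \<in> C" for a b
  proof -
    obtain p where p: "walk C F w a p" using ab(1) walkC unfolding C_def by blast
    obtain q where q: "walk C F w b q" using ab(2) walkC unfolding C_def by blast
    show ?thesis
    \<comment> \<open>Both walks start at \<open>w\<close>, which has to be dropped from
      \<open>q\<close> before the reversed \<open>p\<close> can be joined to it.\<close>
    proof (cases "tl q")
      case Nil
      then have "b = w" using q by (cases q) (auto simp: walk_def)
      then show ?thesis using rev[OF p] by auto
    next
      case (Cons z r)
      then have "q = w # z # r" using q by (cases q) (auto simp: walk_def)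
      then have "walk C F z b (z # r)" "{w, z} \<in> F" using q by (auto simp: walk_def)
      then show ?thesis using walk_append[OF rev[OF p]] by blast
    qed
  qed
  \<comment> \<open>A boundary vertex is not \<open>v\<close>, which has no neighbour in
    \<open>C\<close>, and not in \<open>N\<close>, since it would then belong to \<open>C\<close>;
    so it is a neighbour of \<open>v\<close>.\<close>
  have SN: "{v, s} \<in> F" "s \<in> V" if s: "s \<in> S" for s
  proof -
    show "s \<in> V" using s by (simp add: S_def)
    obtain c where c: "c \<in> C" "{s, c} \<in> F" "s \<notin> C" using s unfolding S_def by blast
    have "s \<noteq> v" using c CN unfolding N_def by auto
    moreover have "s \<notin> N" using ext[of c s] c by (auto simp: insert_commute)
    ultimately show "{v, s} \<in> F" using \<open>s \<in> V\<close> unfolding N_def by auto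
  qed
  have CV: "C \<subseteq> V" "v \<notin> C" "\<And>c. c \<in> C \<Longrightarrow> {v, c} \<notin> F" using CN unfolding N_def by auto
  have clique: "{x, y} \<in> F" if xy: "x \<in> S" "y \<in> S" "x \<noteq> y" for x y
  proof -
    obtain a b where "a \<in> C" "{x, a} \<in> F" "b \<in> C" "{y, b} \<in> F"
      using xy unfolding S_def by blast
    then show ?thesis
      using chordal_separator_clique[OF less.prems(2) loop CV(1) conn less.prems(3) CV(2,3)]
        SN xy by blast
  qed
  let ?V = "C \<union> S"
  have sub: "?V \<subseteq> V" using CV unfolding S_def by auto
  have "v \<notin> ?V" using CV SN loop by (metis Un_iff insert_absorb2)
  then have "?V \<subset> V" using sub less.prems(3) by blast
  then have small: "card ?V < card V" "finite ?V"
    using less.prems(1) finite_subset[OF sub] by (simp_all add: psubset_card_mono)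
  have ch: "chordal ?V F"
    using less.prems(2) sub unfolding chordal_def induced_cycle_def by blast
  have lift: "\<exists>t\<in>V. t \<noteq> v \<and> {v, t} \<notin> F \<and> simplicial_vertex V F t"
    if "t \<in> C" "simplicial_vertex ?V F t" for t
  proof -
    have "a \<in> ?V" if "a \<in> V" "{t, a} \<in> F" for a
      using that \<open>t \<in> C\<close> unfolding S_def by (auto simp: insert_commute)
    then have "simplicial_vertex V F t" using that(2) unfolding simplicial_vertex_def by blast
    then show ?thesis using that(1) CV by (intro bexI[of _ t]) auto
  qed
  have ind: "\<exists>t\<in>?V. t \<noteq> z \<and> {z, t} \<notin> F \<and> simplicial_vertex ?V F t"
    if "z \<in> ?V" "u \<in> ?V" "z \<noteq> u" "{z, u} \<notin> F" for z u
    using less.hyps[OF small(1,2) ch that] .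
  \<comment> \<open>The induction hypothesis must return a vertex in \<open>C\<close>. Applied at
    some \<open>s \<in> S\<close>, it does so because \<open>S\<close> is a clique. If each
    \<open>s \<in> S\<close> is adjacent to all other vertices, it is applied at some
    \<open>c \<in> C\<close> instead. If no two vertices are nonadjacent, \<open>w\<close> itself
    serves.\<close>
  consider s u where "s \<in> S" "u \<in> ?V" "s \<noteq> u" "{s, u} \<notin> F"
    | c u where "c \<in> C" "u \<in> ?V" "c \<noteq> u" "{c, u} \<notin> F"
        "\<And>s u. \<lbrakk>s \<in> S; u \<in> ?V; s \<noteq> u\<rbrakk> \<Longrightarrow> {s, u} \<in> F"
    | "\<And>z u. \<lbrakk>z \<in> ?V; u \<in> ?V; z \<noteq> u\<rbrakk> \<Longrightarrow> {z, u} \<in> F"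
    by blast
  then show ?case
  proof cases
    case 1
    then obtain t where t: "t \<in> ?V" "t \<noteq> s" "{s, t} \<notin> F" "simplicial_vertex ?V F t"
      using ind[of s u] by blast
    then have "t \<in> C" using clique[of s t] 1 by blast
    then show ?thesis using lift t by blast
  next
    case 2
    then obtain t where t: "t \<in> ?V" "t \<noteq> c" "{c, t} \<notin> F" "simplicial_vertex ?V F t"
      using ind[of c u] by blast
    then have "t \<in> C" using 2(5)[of t c] 2(1) by (auto simp: insert_commute)
    then show ?thesis using lift t by blast
  next
    case 3
    then have "simplicial_vertex ?V F w" unfolding simplicial_vertex_def using sub
      by blast
    then show ?thesis using lift wC by blast
  qed
qed

text \<open>Two nonadjacent vertices reduce this to the previous lemma; in a complete graph every
  vertex is simplicial.\<close>

lemma chordal_simplicial_vertex: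
  assumes "finite V" "V \<noteq> {}" "chordal V F" "\<And>a. {a} \<notin> F"
  shows "\<exists>t\<in>V. simplicial_vertex V F t"
proof (cases "\<exists>v\<in>V. \<exists>w\<in>V. v \<noteq> w \<and> {v, w} \<notin> F")
  case True
  then show ?thesis using chordal_simplicial_nonneighbour[OF assms(1,3,4)] by blast
next
  case False
  then show ?thesis using assms(2) unfolding simplicial_vertex_def by blast
qed

section \<open>Linear quotients for graphs with chordal complement\<close>

lemma linear_quotients_star:
  assumes "finite E" "\<And>e. e \<in> E \<Longrightarrow> card e = 2 \<and> v \<in> e"
  shows "linear_quotients E"
  using assms
proof (induction rule: finite_induct)
  case empty
  show ?case by (rule linear_quotients.empty)
next
  case (insert e E)
  have "\<exists>a\<in>f - e. \<exists>g\<in>E. g \<subseteq> insert a e" if f: "f \<in> E" for f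
  proof -
    obtain a where a: "f = {v, a}" using card_2_other[of f v] insert.prems[of f] f by blast
    have "v \<in> e" "\<not> f \<subseteq> e"
      using insert.hyps(2) insert.prems f card_2_subset_eq[of f e] by auto
    \<comment> \<open>The earlier edge \<open>f\<close> serves as its own witness \<open>g\<close>,
      so the edges at \<open>v\<close> may come in any order.\<close>
    then have "a \<in> f - e" "f \<subseteq> insert a e" using a \<open>v \<in> e\<close> by auto
    then show ?thesis using f by blast
  qed
  then show ?case using insert by (intro linear_quotients.insert) auto
qed

text \<open>The ordering lists \<open>F\<close> first and then \<open>E\<close> in its own order;
  the last premise treats a later \<open>e\<close> against an earlier \<open>f\<close>.\<close>

lemma linear_quotients_Un:
  assumes "linear_quotients E" "linear_quotients F"
    and "\<And>e f. \<lbrakk>e \<in> E; f \<in> F\<rbrakk> \<Longrightarrow> \<exists>a\<in>f - e. \<exists>g\<in>F. g \<subseteq> insert a e"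
  shows "linear_quotients (E \<union> F)"
  using assms
proof (induction rule: linear_quotients.induct)
  case (insert E e)
  have IH: "linear_quotients (E \<union> F)" using insert by blast
  show ?case
  proof (cases "e \<in> F")
    case True
    then show ?thesis using IH by (simp add: insert_absorb)
  next
    case False
    have "\<exists>a\<in>f - e. \<exists>g\<in>E \<union> F. g \<subseteq> insert a e" if f: "f \<in> E \<union> F" for f
    proof -
      have "\<exists>a\<in>f - e. \<exists>g\<in>E. g \<subseteq> insert a e" if "f \<in> E" using insert.hyps(3) that .
      moreover have "\<exists>a\<in>f - e. \<exists>g\<in>F. g \<subseteq> insert a e" if "f \<in> F"
        using insert.prems(2)[of e f] that by simp
      ultimately show ?thesis using f by (meson UnE UnI1 UnI2)
    qed
    then show ?thesis using linear_quotients.insert[OF IH, of e] False insert.hyps(2) by simp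
  qed
qed simp

lemma chordal_complement_linear_quotients:
  assumes G: "fin_simple_graph V E" and ch: "chordal V (complement_edges V E)"
  shows "linear_quotients E"
proof -
  let ?F = "complement_edges V E"
  have two: "card e = 2" "e \<subseteq> V" if "e \<in> E" for e
    using G that unfolding fin_simple_graph_def by auto
  have finE: "finite E" using G unfolding fin_simple_graph_def
    by (meson Pow_iff finite_Pow_iff finite_subset subsetI)
  have loop: "{a} \<notin> ?F" for a unfolding complement_edges_def by simp
  \<comment> \<open>Chordality of the complement passes to induced subgraphs, so simplicial vertices
    can be removed one after another.\<close>
  have "linear_quotients {e \<in> E. e \<subseteq> W}" if "W \<subseteq> V" for W
  proof -
    have "finite W" using that G unfolding fin_simple_graph_def by (meson finite_subset)
    then show ?thesis using that
    proof (induction "card W" arbitrary: W rule: less_induct)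
      case less
      show ?case
      proof (cases "W = {}")
        case True
        then have none: "{e \<in> E. e \<subseteq> W} = {}" using two by fastforce
        show ?thesis unfolding none by (rule linear_quotients.empty)
      next
        case False
        have "chordal W ?F"
          using ch less.prems unfolding chordal_def induced_cycle_def by blast
        then obtain v where v: "v \<in> W" "simplicial_vertex W ?F v"
          using chordal_simplicial_vertex[of W ?F] less.prems False loop by blast
        have "card (W - {v}) < card W" using v less.prems by (intro card_Diff1_less)
        then have "linear_quotients {e \<in> E. e \<subseteq> W - {v}}" using less by blast
        moreover have "linear_quotients {e \<in> E. e \<subseteq> W \<and> v \<in> e}"
          using finE two by (intro linear_quotients_star[of _ v]) auto
        \<comment> \<open>The variable is \<open>v\<close> itself. If neither end of
          \<open>e\<close> were a neighbour of \<open>v\<close> in the graph, both would be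
          neighbours in the complement, and simpliciality would make \<open>e\<close> a
          non-edge.\<close>
        moreover have "\<exists>a\<in>f - e. \<exists>g\<in>{e \<in> E. e \<subseteq> W \<and> v \<in> e}. g \<subseteq> insert a e"
          if e: "e \<in> {e \<in> E. e \<subseteq> W - {v}}" and f: "f \<in> {e \<in> E. e \<subseteq> W \<and> v \<in> e}" for e f
        proof -
          obtain a b where ab: "e = {a, b}" "a \<noteq> b" using two[of e] e by (auto simp: card_2_iff)
          then have abW: "a \<in> W" "b \<in> W" "v \<noteq> a" "v \<noteq> b" "{a, b} \<in> E" using e by auto
          then have "{a, b} \<notin> ?F" unfolding complement_edges_def by simp
          then have "{v, a} \<notin> ?F \<or> {v, b} \<notin> ?F"
            using v(2) abW ab unfolding simplicial_vertex_def by blast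
          then have "{v, a} \<in> E \<or> {v, b} \<in> E"
            using abW v less.prems unfolding complement_edges_def by auto
          then have "\<exists>g\<in>{e \<in> E. e \<subseteq> W \<and> v \<in> e}. g \<subseteq> insert v e"
            using ab abW v by auto
          moreover have "v \<in> f - e" using e f by auto
          ultimately show ?thesis by blast
        qed
        ultimately have "linear_quotients ({e \<in> E. e \<subseteq> W - {v}} \<union> {e \<in> E. e \<subseteq> W \<and> v \<in> e})"
          by (rule linear_quotients_Un)
        moreover have "{e \<in> E. e \<subseteq> W - {v}} \<union> {e \<in> E. e \<subseteq> W \<and> v \<in> e} = {e \<in> E. e \<subseteq> W}"
          by auto
        ultimately show ?thesis by simp
      qed
    qed
  qed
  moreover have "{e \<in> E. e \<subseteq> V} = E" using two by auto
  ultimately show ?thesis by (metis order_refl)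
qed

section \<open>Monomial ideals and the lcm-lattice\<close>

lemma mon_dvd_iff: "mon_dvd s t \<longleftrightarrow> (\<forall>x. Poly_Mapping.lookup s x \<le> Poly_Mapping.lookup t x)"
proof
  assume le: "\<forall>x. Poly_Mapping.lookup s x \<le> Poly_Mapping.lookup t x"
  have "t = s + (t - s)"
    using le by (intro poly_mapping_eqI) (simp add: lookup_add lookup_minus)
  then show "mon_dvd s t" unfolding mon_dvd_def by blast
qed (auto simp: mon_dvd_def lookup_add)

lemma mon_dvd_trans: "mon_dvd s t \<Longrightarrow> mon_dvd t u \<Longrightarrow> mon_dvd s u"
  by (meson mon_dvd_iff order_trans)

lemma mon_dvd_antisym: "mon_dvd s t \<Longrightarrow> mon_dvd t s \<Longrightarrow> s = t"
  by (intro poly_mapping_eqI) (simp add: mon_dvd_iff antisym)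

lemma mon_dvd_refl: "mon_dvd s s"
  by (simp add: mon_dvd_iff)

lemma mon_dvd_add: "mon_dvd s t \<Longrightarrow> mon_dvd s (u + t)"
  by (simp add: mon_dvd_iff lookup_add trans_le_add2)

section \<open>The polynomial ring and ideals generated by monomials\<close>

lemma keys_mult_subset:
  fixes p q :: "('a, 'k::field) mpol"
  assumes "m \<in> Poly_Mapping.keys (p * q)"
  obtains a b where "a \<in> Poly_Mapping.keys p" "b \<in> Poly_Mapping.keys q" "m = a + b"
  using assms keys_mult[of p q] by blast

lemma carrier_poly_ring_mult:
  fixes p q :: "('a, 'k::field) mpol"
  assumes "p \<in> carrier (poly_ring V)" "q \<in> carrier (poly_ring V)"
  shows "p * q \<in> carrier (poly_ring V)"
proof -
  have "Poly_Mapping.keys m \<subseteq> V" if "m \<in> Poly_Mapping.keys (p * q)" for m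
    using that
  proof (rule keys_mult_subset)
    fix a b assume "a \<in> Poly_Mapping.keys p" "b \<in> Poly_Mapping.keys q" "m = a + b"
    then show "Poly_Mapping.keys m \<subseteq> V"
      using assms keys_add[of a b] by (fastforce simp: poly_ring_def)
  qed
  then show ?thesis by (simp add: poly_ring_def)
qed

lemma carrier_poly_ring_add:
  fixes p q :: "('a, 'k::field) mpol"
  assumes "p \<in> carrier (poly_ring V)" "q \<in> carrier (poly_ring V)"
  shows "p + q \<in> carrier (poly_ring V)"
  using assms keys_add[of p q] by (simp add: poly_ring_def) blast

lemma carrier_poly_ring_zero_one: "0 \<in> carrier (poly_ring V)" "1 \<in> carrier (poly_ring V)"
  by (simp_all add: poly_ring_def)

lemma poly_ring_simps:
  "mult (poly_ring V) = (*)" "one (poly_ring V) = 1" "zero (poly_ring V) = 0" "add (poly_ring V) = (+)"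
  by (simp_all add: poly_ring_def)

lemma ring_poly_ring: "ring (poly_ring V :: ('a, 'k::field) mpol ring)"
proof (intro ringI abelian_groupI monoidI)
  fix x :: "('a, 'k) mpol" assume "x \<in> carrier (poly_ring V)"
  then show "\<exists>y\<in>carrier (poly_ring V). y \<oplus>\<^bsub>poly_ring V\<^esub> x = \<zero>\<^bsub>poly_ring V\<^esub>"
    by (intro bexI[of _ "- x"]) (simp_all add: poly_ring_def)
qed (simp_all add: poly_ring_simps carrier_poly_ring_add carrier_poly_ring_mult
      carrier_poly_ring_zero_one algebra_simps)

text \<open>An explicit form of the ideal generated by the monomials in \<open>M\<close>, from which
  membership of a monomial can be read off.\<close>

definition mon_multiples :: "'a set \<Rightarrow> 'a mon set \<Rightarrow> ('a, 'k::field) mpol set" where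
  "mon_multiples V M =
     {p \<in> carrier (poly_ring V). \<forall>m\<in>Poly_Mapping.keys p. \<exists>b\<in>M. mon_dvd b m}"

lemma mon_pol_in_mon_multiples:
  "(mon_pol m :: ('a, 'k::field) mpol) \<in> mon_multiples V M \<longleftrightarrow>
     Poly_Mapping.keys m \<subseteq> V \<and> (\<exists>b\<in>M. mon_dvd b m)"
  by (simp add: mon_multiples_def mon_pol_def poly_ring_def)

lemma ideal_mon_multiples: "ideal (mon_multiples V M) (poly_ring V :: ('a, 'k::field) mpol ring)"
proof -
  interpret R: ring "poly_ring V :: ('a, 'k) mpol ring" by (rule ring_poly_ring)
  have mult: "x * p \<in> mon_multiples V M"
    if p: "p \<in> mon_multiples V M" and x: "x \<in> carrier (poly_ring V)" for p x :: "('a, 'k) mpol"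
  proof -
    have "\<exists>b\<in>M. mon_dvd b m" if "m \<in> Poly_Mapping.keys (x * p)" for m
      using that
    proof (rule keys_mult_subset)
      fix a c assume "c \<in> Poly_Mapping.keys p" "m = a + c"
      then show ?thesis using p mon_dvd_add unfolding mon_multiples_def by blast
    qed
    then show ?thesis using p x carrier_poly_ring_mult[of x V p] by (simp add: mon_multiples_def)
  qed
  have add: "p + q \<in> mon_multiples V M"
    if "p \<in> mon_multiples V M" "q \<in> mon_multiples V M" for p q :: "('a, 'k) mpol"
    using that keys_add[of p q] carrier_poly_ring_add[of p V q]
    by (fastforce simp: mon_multiples_def)
  have neg: "\<ominus>\<^bsub>poly_ring V\<^esub> p = - p" "- p \<in> mon_multiples V M"
    if "p \<in> mon_multiples V M" for p :: "('a, 'k) mpol"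
  proof -
    have "p \<in> carrier (poly_ring V)" "- p \<in> carrier (poly_ring V)"
      using that by (simp_all add: mon_multiples_def poly_ring_def)
    then show "\<ominus>\<^bsub>poly_ring V\<^esub> p = - p"
      by (intro R.minus_equality) (simp_all add: poly_ring_def)
    show "- p \<in> mon_multiples V M" using that by (simp add: mon_multiples_def poly_ring_def)
  qed
  show ?thesis
  proof (rule idealI[OF ring_poly_ring])
    show "subgroup (mon_multiples V M) (add_monoid (poly_ring V :: ('a, 'k) mpol ring))"
    proof (rule R.add.subgroupI)
      show "mon_multiples V M \<subseteq> carrier (poly_ring V)" by (auto simp: mon_multiples_def)
      show "mon_multiples V M \<noteq> {}"
        by (auto simp: mon_multiples_def poly_ring_def intro!: exI[of _ 0])
      show "\<ominus>\<^bsub>poly_ring V\<^esub> p \<in> mon_multiples V M" if "p \<in> mon_multiples V M" for p :: "('a, 'k) mpol"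
        using neg that by simp
      show "p \<oplus>\<^bsub>poly_ring V\<^esub> q \<in> mon_multiples V M"
        if "p \<in> mon_multiples V M" "q \<in> mon_multiples V M" for p q :: "('a, 'k) mpol"
        using add that by (simp add: poly_ring_def)
    qed
  qed (use mult in \<open>simp_all add: poly_ring_def mult.commute\<close>)
qed

lemma poly_mapping_sum_single:
  "p = (\<Sum>m\<in>Poly_Mapping.keys p. Poly_Mapping.single m (Poly_Mapping.lookup p m))"
proof (rule poly_mapping_eqI)
  fix k
  have "(\<Sum>m\<in>Poly_Mapping.keys p. Poly_Mapping.lookup p m when m = k)
      = (if k \<in> Poly_Mapping.keys p then Poly_Mapping.lookup p k else 0)"
    by (simp add: when_def sum.delta)
  then show "Poly_Mapping.lookup p k = Poly_Mapping.lookup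
      (\<Sum>m\<in>Poly_Mapping.keys p. Poly_Mapping.single m (Poly_Mapping.lookup p m)) k"
    by (simp add: lookup_sum lookup_single in_keys_iff)
qed

lemma mon_multiples_subset_ideal:
  fixes I :: "('a, 'k::field) mpol set"
  assumes I: "ideal I (poly_ring V)" "mon_pol ` M \<subseteq> I"
  shows "mon_multiples V M \<subseteq> I"
proof
  interpret ideal I "poly_ring V" by (rule I(1))
  fix p :: "('a, 'k) mpol" assume p: "p \<in> mon_multiples V M"
  \<comment> \<open>The cofactor of the generator absorbs the coefficient \<open>c\<close>.\<close>
  have single: "Poly_Mapping.single m c \<in> I" if m: "m \<in> Poly_Mapping.keys p" for m c
  proof -
    obtain b where b: "b \<in> M" "mon_dvd b m" using p m unfolding mon_multiples_def by blast
    then obtain u where u: "m = b + u" unfolding mon_dvd_def by blast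
    have "Poly_Mapping.keys m \<subseteq> V" using p m by (simp add: mon_multiples_def poly_ring_def)
    moreover have "Poly_Mapping.keys u \<subseteq> Poly_Mapping.keys m"
      unfolding u by (auto simp: in_keys_iff lookup_add)
    ultimately have "Poly_Mapping.single u c \<in> carrier (poly_ring V)"
      by (auto simp: poly_ring_def)
    then have "Poly_Mapping.single u c * mon_pol b \<in> I"
      using I_l_closed[of "mon_pol b" "Poly_Mapping.single u c"] I(2) b(1)
      by (auto simp: poly_ring_def)
    then show ?thesis by (simp add: mon_pol_def mult_single u add.commute)
  qed
  have "(\<Sum>m\<in>S. Poly_Mapping.single m (Poly_Mapping.lookup p m)) \<in> I"
    if "finite S" "S \<subseteq> Poly_Mapping.keys p" for S
    using that
  proof (induction rule: finite_induct)
    case empty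
    then show ?case using additive_subgroup.zero_closed[OF is_additive_subgroup]
      by (simp add: poly_ring_def)
  next
    case (insert m S)
    then show ?case using additive_subgroup.a_closed[OF is_additive_subgroup] single
      by (simp add: poly_ring_def)
  qed
  then show "p \<in> I" using poly_mapping_sum_single[of p] by (metis finite_keys order_refl)
qed

lemma genideal_mon_pol:
  assumes "\<And>m. m \<in> M \<Longrightarrow> Poly_Mapping.keys m \<subseteq> V"
  shows "genideal (poly_ring V) (mon_pol ` M) = (mon_multiples V M :: ('a, 'k::field) mpol set)"
proof
  have "mon_pol ` M \<subseteq> (mon_multiples V M :: ('a, 'k) mpol set)"
    unfolding image_subset_iff mon_pol_in_mon_multiples using assms mon_dvd_refl by blast
  then show "genideal (poly_ring V) (mon_pol ` M) \<subseteq> (mon_multiples V M :: ('a, 'k) mpol set)"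
    by (intro ring.genideal_minimal ring_poly_ring ideal_mon_multiples)
  show "(mon_multiples V M :: ('a, 'k) mpol set) \<subseteq> genideal (poly_ring V) (mon_pol ` M)"
    unfolding genideal_def using mon_multiples_subset_ideal by blast
qed

text \<open>Given another generating set \<open>B\<close>, each \<open>m \<in> M\<close> is
  divisible by some \<open>b \<in> B\<close>, which is divisible by some \<open>n \<in> M\<close>.
  The antichain property collapses these to one monomial, so \<open>M \<subseteq> B\<close>, and
  minimality of \<open>B\<close> gives equality.\<close>

lemma min_mon_gens_antichain:
  fixes I :: "('a, 'k::field) mpol set"
  assumes I: "I = genideal (poly_ring V) (mon_pol ` M)"
    and keys: "\<And>m. m \<in> M \<Longrightarrow> Poly_Mapping.keys m \<subseteq> V"
    and anti: "\<And>m n. \<lbrakk>m \<in> M; n \<in> M; mon_dvd m n\<rbrakk> \<Longrightarrow> m = n"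
  shows "min_mon_gens V I = M"
  unfolding min_mon_gens_def
proof (rule the_equality)
  have IM: "I = mon_multiples V M" using genideal_mon_pol[OF keys] I by simp
  have "genideal (poly_ring V) (mon_pol ` C) \<noteq> I" if C: "C \<subset> M" for C
  proof
    assume "genideal (poly_ring V) (mon_pol ` C) = I"
    then have eq: "mon_multiples V C = I" using genideal_mon_pol[of C V] keys C by auto
    obtain m where m: "m \<in> M" "m \<notin> C" using C by blast
    have "(mon_pol m :: ('a, 'k) mpol) \<in> mon_multiples V C"
      unfolding eq IM mon_pol_in_mon_multiples using m keys mon_dvd_refl by blast
    then obtain b where "b \<in> C" "mon_dvd b m" unfolding mon_pol_in_mon_multiples by blast
    then show False using anti[of b m] m C by blast
  qed
  then show "genideal (poly_ring V) (mon_pol ` M) = I \<and>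
      (\<forall>C. C \<subset> M \<longrightarrow> genideal (poly_ring V) (mon_pol ` C) \<noteq> I)"
    using I by simp
  fix B
  assume B: "genideal (poly_ring V) (mon_pol ` B) = I \<and>
      (\<forall>C. C \<subset> B \<longrightarrow> genideal (poly_ring V) (mon_pol ` C) \<noteq> I)"
  \<comment> \<open>That \<open>B\<close> uses only variables from \<open>V\<close> is not given; it
    follows from its members lying in \<open>I\<close>.\<close>
  have "mon_pol ` B \<subseteq> genideal (poly_ring V :: ('a, 'k) mpol ring) (mon_pol ` B)"
    unfolding genideal_def by blast
  then have BI: "mon_pol ` B \<subseteq> I" using B by simp
  have BM: "Poly_Mapping.keys b \<subseteq> V" "\<exists>m\<in>M. mon_dvd m b" if "b \<in> B" for b
  proof -
    have "(mon_pol b :: ('a, 'k) mpol) \<in> mon_multiples V M" using BI IM that by blast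
    then show "Poly_Mapping.keys b \<subseteq> V" "\<exists>m\<in>M. mon_dvd m b"
      unfolding mon_pol_in_mon_multiples by simp_all
  qed
  have IB: "I = mon_multiples V B" using genideal_mon_pol[of B V] BM(1) B by metis
  have "M \<subseteq> B"
  proof
    fix m assume m: "m \<in> M"
    have "(mon_pol m :: ('a, 'k) mpol) \<in> mon_multiples V B"
      unfolding IB[symmetric] IM mon_pol_in_mon_multiples using m keys mon_dvd_refl by blast
    then obtain b where b: "b \<in> B" "mon_dvd b m" unfolding mon_pol_in_mon_multiples by blast
    then obtain n where n: "n \<in> M" "mon_dvd n b" using BM(2) by blast
    then have "n = m" using anti m b(2) mon_dvd_trans by blast
    then show "m \<in> B" using n b mon_dvd_antisym by blast
  qed
  then show "B = M" using B I by blast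
qed

section \<open>Squarefree monomials as vertex sets\<close>

definition squarefree_mon :: "'a set \<Rightarrow> 'a mon" where
  "squarefree_mon W = (\<Sum>i\<in>W. Poly_Mapping.single i 1)"

text \<open>Finiteness matters here: over an infinite set the defining sum is 0 by
  convention.\<close>

lemma lookup_squarefree_mon:
  assumes "finite W"
  shows "Poly_Mapping.lookup (squarefree_mon W) x = (if x \<in> W then 1 else 0)"
  using assms by (simp add: squarefree_mon_def lookup_sum lookup_single when_def sum.delta)

lemma mon_dvd_squarefree_mon:
  assumes "finite W" "finite U"
  shows "mon_dvd (squarefree_mon W) (squarefree_mon U) \<longleftrightarrow> W \<subseteq> U"
  using assms by (auto simp: mon_dvd_iff lookup_squarefree_mon)

lemma squarefree_mon_eq_iff:
  assumes "finite W" "finite U"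
  shows "squarefree_mon W = squarefree_mon U \<longleftrightarrow> W = U"
proof
  assume "squarefree_mon W = squarefree_mon U"
  then have "mon_dvd (squarefree_mon W) (squarefree_mon U)"
      "mon_dvd (squarefree_mon U) (squarefree_mon W)"
    by (simp_all add: mon_dvd_refl)
  then show "W = U" using assms by (simp add: mon_dvd_squarefree_mon)
qed simp

text \<open>Exponents are 0 or 1, so their maximum corresponds to a union. The empty family yields
  the monomial 1.\<close>

lemma mon_lcm_squarefree_mon:
  assumes "finite (\<Union>A)"
  shows "mon_lcm (squarefree_mon ` A) = squarefree_mon (\<Union>A)"
  unfolding mon_lcm_def
proof (rule the_equality)
  have fin: "finite W" if "W \<in> A" for W using that assms by (meson Union_upper finite_subset)
  have upper: "\<forall>a\<in>squarefree_mon ` A. mon_dvd a (squarefree_mon (\<Union>A))"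
    using fin assms by (auto simp: mon_dvd_squarefree_mon)
  have least: "mon_dvd (squarefree_mon (\<Union>A)) n" if n: "\<forall>a\<in>squarefree_mon ` A. mon_dvd a n" for n
    unfolding mon_dvd_iff lookup_squarefree_mon[OF assms]
  proof
    fix x
    show "(if x \<in> \<Union>A then 1 else 0) \<le> Poly_Mapping.lookup n x"
    proof (cases "x \<in> \<Union>A")
      case True
      then obtain W where W: "W \<in> A" "x \<in> W" by blast
      then have "Poly_Mapping.lookup (squarefree_mon W) x \<le> Poly_Mapping.lookup n x"
        using n by (simp add: mon_dvd_iff)
      then show ?thesis using W fin by (simp add: lookup_squarefree_mon)
    qed simp
  qed
  show "(\<forall>a\<in>squarefree_mon ` A. mon_dvd a (squarefree_mon (\<Union>A))) \<and>
      (\<forall>n. (\<forall>a\<in>squarefree_mon ` A. mon_dvd a n) \<longrightarrow> mon_dvd (squarefree_mon (\<Union>A)) n)"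
    using upper least by blast
  show "m = squarefree_mon (\<Union>A)"
    if m: "(\<forall>a\<in>squarefree_mon ` A. mon_dvd a m) \<and>
      (\<forall>n. (\<forall>a\<in>squarefree_mon ` A. mon_dvd a n) \<longrightarrow> mon_dvd m n)" for m
  proof (rule mon_dvd_antisym)
    show "mon_dvd m (squarefree_mon (\<Union>A))" using m upper by simp
    show "mon_dvd (squarefree_mon (\<Union>A)) m" using m least by simp
  qed
qed

lemma edge_monomials_eq:
  assumes "fin_simple_graph V E"
  shows "edge_monomials E = squarefree_mon ` E"
proof (intro Set.set_eqI iffI)
  have edge: "squarefree_mon {i, j} = Poly_Mapping.single i 1 + Poly_Mapping.single j 1"
    if "{i, j} \<in> E" for i j
  proof -
    \<comment> \<open>Without loops no generator is a square, so the two summands are distinct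
      variables.\<close>
    have "i \<noteq> j" using assms that unfolding fin_simple_graph_def by force
    then show ?thesis by (simp add: squarefree_mon_def)
  qed
  show "m \<in> squarefree_mon ` E" if "m \<in> edge_monomials E" for m
    using that edge unfolding edge_monomials_def by force
  show "m \<in> edge_monomials E" if m: "m \<in> squarefree_mon ` E" for m
  proof -
    obtain e where e: "e \<in> E" "m = squarefree_mon e" using m by blast
    then have "card e = 2" using assms unfolding fin_simple_graph_def by blast
    then obtain i j where "e = {i, j}" by (auto simp: card_2_iff)
    then show ?thesis using e edge unfolding edge_monomials_def by blast
  qed
qed

lemma edge_ideal_eq:
  "edge_ideal V E = genideal (poly_ring V :: ('a, 'k::field) mpol ring) (mon_pol ` edge_monomials E)"
proof -
  have prod: "pol_var i * pol_var j
      = (mon_pol (Poly_Mapping.single i 1 + Poly_Mapping.single j 1) :: ('a, 'k) mpol)" for i j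
    by (simp add: pol_var_def mon_pol_def mult_single)
  have "{pol_var i * pol_var j | i j. {i, j} \<in> E} = (mon_pol ` edge_monomials E :: ('a, 'k) mpol set)"
    unfolding edge_monomials_def prod by blast
  then show ?thesis by (simp add: edge_ideal_def)
qed

text \<open>Edges all have two elements, so none divides another and the antichain criterion
  applies.\<close>

lemma min_mon_gens_edge_ideal:
  assumes G: "fin_simple_graph V E"
  shows "min_mon_gens V (edge_ideal V E :: ('a, 'k::field) mpol set) = squarefree_mon ` E"
proof (rule min_mon_gens_antichain)
  have fin: "finite e" "card e = 2" "e \<subseteq> V" if "e \<in> E" for e
    using G that unfolding fin_simple_graph_def by (auto intro: finite_subset)
  show "edge_ideal V E = genideal (poly_ring V :: ('a, 'k) mpol ring) (mon_pol ` squarefree_mon ` E)"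
    using edge_ideal_eq edge_monomials_eq[OF G] by metis
  show "Poly_Mapping.keys m \<subseteq> V" if "m \<in> squarefree_mon ` E" for m
    using that fin by (fastforce simp: in_keys_iff lookup_squarefree_mon split: if_splits)
  show "m = n" if "m \<in> squarefree_mon ` E" "n \<in> squarefree_mon ` E" "mon_dvd m n" for m n
  proof -
    obtain e f where ef: "e \<in> E" "m = squarefree_mon e" "f \<in> E" "n = squarefree_mon f"
      using \<open>m \<in> _\<close> \<open>n \<in> _\<close> by blast
    then have "e \<subseteq> f" using \<open>mon_dvd m n\<close> fin by (simp add: mon_dvd_squarefree_mon)
    then have "e = f" using ef fin card_subset_eq[of f e] by simp
    then show ?thesis using ef by simp
  qed
qed

lemma order_complex_image:
  assumes "\<And>x y. \<lbrakk>x \<in> P; y \<in> P\<rbrakk> \<Longrightarrow> r (f x) (f y) \<longleftrightarrow> s x y" and inj: "inj_on f P"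
  shows "order_complex r (f ` P) = (`) f ` order_complex s P"
proof -
  have eq: "finite (f ` C) \<and> Complete_Partial_Order.chain r (f ` C) \<longleftrightarrow>
      finite C \<and> Complete_Partial_Order.chain s C" if C: "C \<subseteq> P" for C
  proof -
    have "finite (f ` C) \<longleftrightarrow> finite C" using inj C by (meson finite_image_iff inj_on_subset)
    moreover have "Complete_Partial_Order.chain r (f ` C) \<longleftrightarrow> Complete_Partial_Order.chain s C"
      using assms(1) C unfolding chain_def by (simp add: subset_iff)
    ultimately show ?thesis by simp
  qed
  show ?thesis
  proof
    show "order_complex r (f ` P) \<subseteq> (`) f ` order_complex s P"
    proof
      fix D assume D: "D \<in> order_complex r (f ` P)"
      then obtain C where "C \<subseteq> P" "D = f ` C"
        unfolding order_complex_def by (auto simp: subset_image_iff)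
      then show "D \<in> (`) f ` order_complex s P" using D eq[of C] unfolding order_complex_def by auto
    qed
    show "(`) f ` order_complex s P \<subseteq> order_complex r (f ` P)"
      using eq unfolding order_complex_def by auto
  qed
qed

text \<open>Least common multiples turn into unions: the bottom 1 is the empty union and the top is
  the union of all edges.\<close>

lemma open_interval_lcm_lattice:
  assumes G: "fin_simple_graph V E"
  shows "open_interval mon_dvd (lcm_lattice V (edge_ideal V E :: ('a, 'k::field) mpol set))
      0 (mon_lcm (edge_monomials E))
    = squarefree_mon ` {\<Union>A | A. A \<subseteq> E \<and> \<Union>A \<noteq> {} \<and> \<Union>A \<noteq> \<Union>E}"
proof -
  have finE: "finite (\<Union>E)"
    using G unfolding fin_simple_graph_def by (meson Sup_least finite_subset)
  have fin: "finite (\<Union>A)" if "A \<subseteq> E" for A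
    using finE that by (meson Union_mono finite_subset)
  have lattice: "lcm_lattice V (edge_ideal V E :: ('a, 'k) mpol set)
      = squarefree_mon ` {\<Union>A | A. A \<subseteq> E}" (is "?L = ?R")
  proof
    show "?L \<subseteq> ?R"
    proof
      fix m assume "m \<in> ?L"
      then obtain B where "B \<subseteq> squarefree_mon ` E" "m = mon_lcm B"
        unfolding lcm_lattice_def min_mon_gens_edge_ideal[OF G] by blast
      then obtain A where A: "A \<subseteq> E" "m = mon_lcm (squarefree_mon ` A)"
        by (auto simp: subset_image_iff)
      then have "m = squarefree_mon (\<Union>A)" using mon_lcm_squarefree_mon fin by blast
      then show "m \<in> ?R" using A by blast
    qed
    show "?R \<subseteq> ?L"
    proof
      fix m assume "m \<in> ?R"
      then obtain A where A: "A \<subseteq> E" "m = squarefree_mon (\<Union>A)" by blast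
      then have "m = mon_lcm (squarefree_mon ` A)" using mon_lcm_squarefree_mon fin by metis
      then show "m \<in> ?L"
        unfolding lcm_lattice_def min_mon_gens_edge_ideal[OF G] using A by blast
    qed
  qed
  have top: "mon_lcm (edge_monomials E) = squarefree_mon (\<Union>E)"
    using edge_monomials_eq[OF G] mon_lcm_squarefree_mon finE by metis
  have bot: "0 = squarefree_mon {}" by (simp add: squarefree_mon_def)
  \<comment> \<open>Both divisibilities hold automatically between the empty set and
    \<open>\<Union>E\<close>; only the two inequations carry information.\<close>
  have mem: "(mon_dvd 0 (squarefree_mon (\<Union>A)) \<and> squarefree_mon (\<Union>A) \<noteq> 0 \<and>
      mon_dvd (squarefree_mon (\<Union>A)) (squarefree_mon (\<Union>E)) \<and>
      squarefree_mon (\<Union>A) \<noteq> squarefree_mon (\<Union>E)) \<longleftrightarrow> \<Union>A \<noteq> {} \<and> \<Union>A \<noteq> \<Union>E"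
    if A: "A \<subseteq> E" for A
    using Union_mono[OF A] fin[OF A] finE
    by (simp only: bot mon_dvd_squarefree_mon squarefree_mon_eq_iff finite.emptyI) blast
  show ?thesis
  proof (intro Set.set_eqI iffI)
    fix m
    assume "m \<in> open_interval mon_dvd (lcm_lattice V (edge_ideal V E :: ('a, 'k) mpol set))
      0 (mon_lcm (edge_monomials E))"
    then have m: "m \<in> ?R \<and> mon_dvd 0 m \<and> m \<noteq> 0 \<and> mon_dvd m (squarefree_mon (\<Union>E)) \<and>
        m \<noteq> squarefree_mon (\<Union>E)"
      unfolding open_interval_def lattice top mem_Collect_eq .
    then obtain A where A: "A \<subseteq> E" "m = squarefree_mon (\<Union>A)" by blast
    then have "\<Union>A \<noteq> {} \<and> \<Union>A \<noteq> \<Union>E" using mem[OF A(1)] m by simp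
    then show "m \<in> squarefree_mon ` {\<Union>A | A. A \<subseteq> E \<and> \<Union>A \<noteq> {} \<and> \<Union>A \<noteq> \<Union>E}"
      using A by blast
  next
    fix m assume "m \<in> squarefree_mon ` {\<Union>A | A. A \<subseteq> E \<and> \<Union>A \<noteq> {} \<and> \<Union>A \<noteq> \<Union>E}"
    then obtain A where A: "A \<subseteq> E" "\<Union>A \<noteq> {} \<and> \<Union>A \<noteq> \<Union>E" "m = squarefree_mon (\<Union>A)" by blast
    then have "m \<in> ?R" by blast
    moreover note mem[OF A(1), THEN iffD2, OF A(2), folded A(3)]
    ultimately show "m \<in> open_interval mon_dvd (lcm_lattice V (edge_ideal V E :: ('a, 'k) mpol set))
      0 (mon_lcm (edge_monomials E))"
      unfolding open_interval_def lattice top mem_Collect_eq by (rule conjI)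
  qed
qed

theorem theorem3p1:
  fixes V :: "'a set" and E :: "'a set set"
  assumes "fin_simple_graph V E"
    and "chordal V (complement_edges V E)"
  shows "constructible
           (order_complex mon_dvd
             (open_interval mon_dvd
               (lcm_lattice V (edge_ideal V E :: ('a, 'k::field) mpol set))
               0 (mon_lcm (edge_monomials E))))"
proof -
  define P where "P = {\<Union>A | A. A \<subseteq> E \<and> \<Union>A \<noteq> {} \<and> \<Union>A \<noteq> \<Union>E}"
  have finE: "finite (\<Union>E)"
    using assms(1) unfolding fin_simple_graph_def by (meson Sup_least finite_subset)
  have two: "card e = 2" if "e \<in> E" for e
    using assms(1) that unfolding fin_simple_graph_def by simp
  have fin: "finite x" if "x \<in> P" for x
  proof -
    have "x \<subseteq> \<Union>E" using that unfolding P_def by blast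
    then show ?thesis using finE by (rule finite_subset)
  qed
  have inj: "inj_on squarefree_mon P"
    by (rule inj_onI) (simp add: squarefree_mon_eq_iff fin)
  have "constructible (order_complex (\<subseteq>) P)"
    unfolding P_def
    by (rule constructible_edge_unions[OF chordal_complement_linear_quotients[OF assms] finE two])
  moreover have "\<Union>(order_complex (\<subseteq>) P) \<subseteq> P" unfolding order_complex_def by blast
  ultimately have "constructible ((`) squarefree_mon ` order_complex (\<subseteq>) P)"
    using inj_on_subset[OF inj] by (intro constructible_image)
  moreover have "order_complex mon_dvd (squarefree_mon ` P)
      = (`) squarefree_mon ` order_complex (\<subseteq>) P"
    by (rule order_complex_image[OF _ inj]) (simp add: mon_dvd_squarefree_mon fin)
  ultimately show ?thesis
    by (simp only: open_interval_lcm_lattice[OF assms(1)] P_def[symmetric])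
qed

end
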